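(* Let $e=2$, $a\ge 1$, $\Lambda=a\Lambda_0+a\Lambda_1$, $i\in\{0,1\}$ and $0\le k\le a$. A multipartition derived from the top rows, i.e. from the unique $e$-regular multipartition of weight $\Lambda-k\alpha_i$, under the action of a reduced word of length $n$ in the Weyl group generators is $$\tau^n_i(\tilde S_1),\qquad \tilde S_1=(1^k,0^{a-k}).$$ The canonical basis element of the image of a multipartition from the top rows under the action of a reduced word of length $n$ in the Weyl group generators is $$G(\tau^n_i(\tilde S_1))=\sum_{S_1\in\mathcal S(a,k)}v^{\operatorname{Inv}(S_1)}\,\tau^n_i(S_1).$$ The shape of $G(\tau^n_i(\tilde S_1))$ is $(s(a,k,0),\dots,s(a,k,k(a-k)))$, where $s(a,k,\ell)$ is the recursive function which is $0$ except for $0\le\ell\le k(a-k)$ and satisfies $s(1,0,0)=s(1,1,0)=1$ and $s(a,k,\ell)=s(a-1,k-1,\ell)+s(a-1,k,\ell-k)$.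
   Context: **Fock space.** Let $\mathcal U=\mathcal U_v(\widehat{sl}_2)$ over $\mathbb Q(v)$, and let $\Lambda=a\Lambda_0+a\Lambda_1$, of level $r=2a$. The Fock space has as basis the multipartitions $\lambda=(\lambda^1,\dots,\lambda^{2a})$; components $1,\dots,a$ have corner residue $0$ and components $a+1,\dots,2a$ have corner residue $1$. The node in row $t$, column $u$ of a component with corner residue $c$ has residue $c+u-t \bmod 2$. A node is above another if it lies in an earlier component, or in the same component in a higher row. The generator $f_i$ acts by $f_i(\lambda)=\sum_{\mathfrak n}v^{N(\mathfrak n,i)}\lambda^{\mathfrak n}$, the sum over addable $i$-nodes $\mathfrak n$, where $\lambda^{\mathfrak n}$ is $\lambda$ with $\mathfrak n$ added and $N(\mathfrak n,i)=\#\{\text{addable } i\text{-nodes above }\mathfrak n\}-\#\{\text{removable } i\text{-nodes above }\mathfrak n\}$. Divided powers are $f_i^{(k)}=f_i^k/[k]_v!$, where $[m]_v=v^{m-1}+v^{m-3}+\dots+v^{-(m-1)}$ and $[k]_v!=[k]_v[k-1]_v\cdots[1]_v$. The highest weight vector $u_\Lambda$ is the empty multipartition. A multipartition with $c_0$ nodes of residue $0$ and $c_1$ nodes of residue $1$ has weight $\Lambda-c_0\alpha_0-c_1\alpha_1$; the defect of $\Lambda-\alpha$ is $(\Lambda\mid\alpha)-\frac12(\alpha\mid\alpha)$. **Crystal.** For a residue $i$, write from left to right a $+$ for each addable and a $-$ for each removable $i$-node, going from bottom to top, and cancel all pairs "$-+$" repeatedly. The crystal operator $\tilde f_i$ adds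 the node corresponding to the rightmost remaining $+$ (giving $0$ if there is none). The multipartitions obtained from the empty one by these operators are the $e$-regular multipartitions; they are the vertices of the Kashiwara crystal, and the maximal chains under $\tilde f_i$ are its $i$-strings. The Weyl group is generated by reflections $s_0,s_1$; $s_i$ acts on the crystal by reflecting each $i$-string, so it carries an element at one end of its $i$-string to the other end. **Canonical basis.** For each $e$-regular multipartition $\mu$, $G(\mu)$ is the unique element of the $\mathbb Z[v,v^{-1}]$-span of the vectors $f_{i_1}^{(k_1)}\cdots f_{i_m}^{(k_m)}u_\Lambda$ that is invariant under the bar involution (fixing the $f_i$ and $u_\Lambda$, and interchanging $v$ and $v^{-1}$) and has the form $\mu+\sum_{\lambda\ne\mu}d_{\lambda\mu}(v)\lambda$ with $d_{\lambda\mu}(v)\in v\mathbb Z[v]$. The shape of a canonical basis element is the sequence giving, for each power of $v$ from $0$ to the defect, the number of multipartitions, counting repetitions, occurring with that power. **Choice sequences.** $\mathcal S(c,k)$ is the set of $0/1$-sequences of length $c$ with exactly $k$ entries equal to $1$; $\operatorname{Inv}(S)$ is the sum, over the entries $1$ of $S$, of the number of entries $0$ appearing before it. **The multipartitions $\tau$.** $T_n=(n,n-1,\dots,1)$ if $n>0$, and $T_n=\emptyset$ otherwise. For $S_1\in\mathcal S(a,k)$, $\tau_i^n(S_1)$ is the multipartition whose component $u$ ($1\le u\le 2a$) is $T_{n+1}$ if $1\le u-ia\le a$ and $(S_1)_{u-ia}=1$; $T_{n-1}$ if $1\le u-ia\le a$ and $(S_1)_{u-ia}=0$; and $T_n$ for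 the remaining $a$ components.
   Formalization: The reduced word, when non-empty, is required to act first by s_{1-i}; for every reduced word of length n≥1 acting first by s_i the stated formula fails, since s_i carries the top-row multipartition for k to the one for a-k and the result is τ_i^{n-1}(1^{a-k},0^k). *)

theory Defs
  imports
    "HOL-Library.Poly_Mapping"
    "HOL-Library.Product_Lexorder"
    "HOL-Computational_Algebra.Computational_Algebra"
    "HOL-Computational_Algebra.Field_as_Ring"
begin

section \<open>The field of rational functions in v\<close>

type_synonym qv = "rat poly fract"

definition v :: qv where "v = to_fract [:0, 1:]"

definition int_polys :: "qv set" where
  "int_polys = range (\<lambda>p :: int poly. poly (map_poly of_int p) v)"

definition int_laurent_polys :: "qv set" where
  "int_laurent_polys = {p / v ^ m | p m. p \<in> int_polys}"

text \<open>The field automorphism interchanging \<open>v\<close> and its inverse.\<close>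

definition bar_coeff :: "qv \<Rightarrow> qv" where
  "bar_coeff c = (case quot_of_fract c of (p, q) \<Rightarrow>
     poly (map_poly (\<lambda>r. to_fract [:r:]) p) (inverse v) /
     poly (map_poly (\<lambda>r. to_fract [:r:]) q) (inverse v))"

definition qint :: "nat \<Rightarrow> qv" where
  "qint m = (\<Sum>j<m. v powi (int m - 1 - 2 * int j))"

definition qfact :: "nat \<Rightarrow> qv" where
  "qfact m = (\<Prod>j=1..m. qint j)"

section \<open>Multipartitions\<close>

text \<open>A multipartition is encoded by its row lengths: \<open>la c t\<close> is the length of row \<open>t\<close> of
  component \<open>c\<close>, padded by zeros. Only functions reached from the empty
  multipartition by adding addable nodes occur; these have weakly decreasing rows, finitely many
  nonzero rows and no nodes outside the components \<open>0, \<dots>, 2 a - 1\<close>. Components, rows and columns are numbered from 0, so that the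
  components with corner residue 0 are those with \<open>c < a\<close>. Numbering rows and columns from 0
  does not affect residues. Throughout, \<open>a\<close> is the parameter of the dominant weight
  \<open>\<Lambda> = a \<Lambda>\<^sub>0 + a \<Lambda>\<^sub>1\<close>, and residues are the natural numbers 0 and 1.\<close>

type_synonym mpart = "nat \<Rightarrow> nat \<Rightarrow> nat"
type_synonym node = "nat \<times> nat \<times> nat"  \<comment> \<open>component, row, column\<close>

definition empty_mpart :: mpart where "empty_mpart = (\<lambda>c t. 0)"

definition nodes :: "mpart \<Rightarrow> node set" where
  "nodes la = {(c, t, u). u < la c t}"

fun residue :: "nat \<Rightarrow> node \<Rightarrow> nat" where
  "residue a (c, t, u) = nat (((if c < a then 0 else 1) + int u - int t) mod 2)"

fun above :: "node \<Rightarrow> node \<Rightarrow> bool" where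
  "above (c, t, u) (c', t', u') \<longleftrightarrow> c < c' \<or> c = c' \<and> t < t'"

definition addable :: "nat \<Rightarrow> nat \<Rightarrow> mpart \<Rightarrow> node set" where
  "addable a i la = {(c, t, u). c < 2 * a \<and> u = la c t \<and> (t = 0 \<or> la c t < la c (t - 1)) \<and>
     residue a (c, t, u) = i}"

definition removable :: "nat \<Rightarrow> nat \<Rightarrow> mpart \<Rightarrow> node set" where
  "removable a i la = {(c, t, u). c < 2 * a \<and> Suc u = la c t \<and> la c (Suc t) < la c t \<and>
     residue a (c, t, u) = i}"

fun add_node :: "mpart \<Rightarrow> node \<Rightarrow> mpart" where
  "add_node la (c, t, u) = la(c := (la c)(t := Suc (la c t)))"

section \<open>Weights and defect\<close>

text \<open>The weight \<open>\<Lambda> - c\<^sub>0 \<alpha>\<^sub>0 - c\<^sub>1 \<alpha>\<^sub>1\<close> is represented by the pair \<open>(c\<^sub>0, c\<^sub>1)\<close>.\<close>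

definition weight :: "nat \<Rightarrow> mpart \<Rightarrow> nat \<times> nat" where
  "weight a la =
     (card {n \<in> nodes la. residue a n = 0}, card {n \<in> nodes la. residue a n = 1})"

text \<open>The pair for \<open>\<Lambda> - k \<alpha>\<^sub>i\<close>.\<close>

definition top_weight :: "nat \<Rightarrow> nat \<Rightarrow> nat \<times> nat" where
  "top_weight i k = (if i = 0 then (k, 0) else (0, k))"

text \<open>The defect is \<open>(\<Lambda> | \<alpha>) - (\<alpha> | \<alpha>) / 2\<close>, where \<open>(\<Lambda>\<^sub>i | \<alpha>\<^sub>j)\<close> is the Kronecker delta,
  \<open>(\<alpha>\<^sub>i | \<alpha>\<^sub>i) = 2\<close> and \<open>(\<alpha>\<^sub>0 | \<alpha>\<^sub>1) = -2\<close>.\<close>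

definition defect :: "nat \<Rightarrow> nat \<times> nat \<Rightarrow> int" where
  "defect a = (\<lambda>(c0, c1). let x = int c0; y = int c1 in
     (int a * x + int a * y) - (2 * x\<^sup>2 - 4 * x * y + 2 * y\<^sup>2) div 2)"

section \<open>The Fock space\<close>

type_synonym fock = "mpart \<Rightarrow>\<^sub>0 qv"

definition scale :: "qv \<Rightarrow> fock \<Rightarrow> fock" where
  "scale c x = Poly_Mapping.map (\<lambda>d. c * d) x"

definition vac :: fock where "vac = Poly_Mapping.single empty_mpart 1"

definition N_above :: "nat \<Rightarrow> nat \<Rightarrow> mpart \<Rightarrow> node \<Rightarrow> int" where
  "N_above a i la n =
     int (card {m \<in> addable a i la. above m n}) - int (card {m \<in> removable a i la. above m n})"

definition fock_f :: "nat \<Rightarrow> nat \<Rightarrow> fock \<Rightarrow> fock" where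
  "fock_f a i x = (\<Sum>la\<in>Poly_Mapping.keys x. \<Sum>n\<in>addable a i la.
     Poly_Mapping.single (add_node la n) (Poly_Mapping.lookup x la * v powi N_above a i la n))"

definition divided_power :: "nat \<Rightarrow> nat \<Rightarrow> nat \<Rightarrow> fock \<Rightarrow> fock" where
  "divided_power a i k x = scale (1 / qfact k) ((fock_f a i ^^ k) x)"

section \<open>The crystal\<close>

text \<open>A signature is read from left to right; \<open>True\<close> stands for + and \<open>False\<close> for -.
  The lexicographic order on nodes lists them from top to bottom; at most one addable or
  removable node of a given residue lies in each row.\<close>

definition signature :: "nat \<Rightarrow> nat \<Rightarrow> mpart \<Rightarrow> (bool \<times> node) list" where
  "signature a i la = map (\<lambda>n. (n \<in> addable a i la, n))
     (rev (sorted_list_of_set (addable a i la \<union> removable a i la)))"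

fun cancel :: "(bool \<times> node) list \<Rightarrow> (bool \<times> node) list" where
  "cancel [] = []"
| "cancel (x # w) = (let w' = cancel w in
     if \<not> fst x \<and> w' \<noteq> [] \<and> fst (hd w') then tl w' else x # w')"

definition crystal_f :: "nat \<Rightarrow> nat \<Rightarrow> mpart \<Rightarrow> mpart option" where
  "crystal_f a i la = (let ps = filter fst (cancel (signature a i la)) in
     if ps = [] then None else Some (add_node la (snd (last ps))))"

inductive e_regular :: "nat \<Rightarrow> mpart \<Rightarrow> bool" for a where
  empty: "e_regular a empty_mpart"
| step: "\<lbrakk>e_regular a la; i < 2; crystal_f a i la = Some mu\<rbrakk> \<Longrightarrow> e_regular a mu"

definition is_string :: "nat \<Rightarrow> nat \<Rightarrow> mpart list \<Rightarrow> bool" where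
  "is_string a i ms \<longleftrightarrow> ms \<noteq> [] \<and> (\<forall>la\<in>set ms. e_regular a la) \<and>
     (\<forall>j. Suc j < length ms \<longrightarrow> crystal_f a i (ms ! j) = Some (ms ! Suc j)) \<and>
     crystal_f a i (last ms) = None \<and>
     \<not> (\<exists>la. e_regular a la \<and> crystal_f a i la = Some (hd ms))"

definition crystal_s :: "nat \<Rightarrow> nat \<Rightarrow> mpart \<Rightarrow> mpart" where
  "crystal_s a i la = (THE mu. \<exists>ms j. is_string a i ms \<and> j < length ms \<and>
     ms ! j = la \<and> ms ! (length ms - 1 - j) = mu)"

text \<open>The last letter of a word acts first.\<close>

definition crystal_word :: "nat \<Rightarrow> nat list \<Rightarrow> mpart \<Rightarrow> mpart" where
  "crystal_word a w la = foldr (crystal_s a) w la"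

text \<open>The Weyl group is identified with its image under the (faithful) action on the root lattice,
  where \<open>(x, y)\<close> stands for \<open>x \<alpha>\<^sub>0 + y \<alpha>\<^sub>1\<close>.\<close>

definition root_s :: "nat \<Rightarrow> int \<times> int \<Rightarrow> int \<times> int" where
  "root_s i = (\<lambda>(x, y). if i = 0 then (x - (2 * x - 2 * y), y) else (x, y - (2 * y - 2 * x)))"

definition reduced_word :: "nat list \<Rightarrow> bool" where
  "reduced_word w \<longleftrightarrow> set w \<subseteq> {0, 1} \<and>
     (\<forall>w'. set w' \<subseteq> {0, 1} \<and> foldr root_s w' = foldr root_s w \<longrightarrow> length w \<le> length w')"

section \<open>The canonical basis\<close>

inductive_set integral_form :: "nat \<Rightarrow> fock set" for a where
  zero: "0 \<in> integral_form a"
| monomial: "\<lbrakk>set (map fst iks) \<subseteq> {0, 1}; c \<in> int_laurent_polys; x \<in> integral_form a\<rbrakk> \<Longrightarrow>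
     scale c (foldr (\<lambda>(i, k). divided_power a i k) iks vac) + x \<in> integral_form a"

text \<open>The graph of the bar involution of the submodule generated by \<open>vac\<close>: the smallest
  semilinear relation that fixes \<open>vac\<close> and commutes with the generators.\<close>

inductive bar_graph :: "nat \<Rightarrow> fock \<Rightarrow> fock \<Rightarrow> bool" for a where
  vac: "bar_graph a vac vac"
| f: "\<lbrakk>bar_graph a x y; i < 2\<rbrakk> \<Longrightarrow> bar_graph a (fock_f a i x) (fock_f a i y)"
| add: "\<lbrakk>bar_graph a x y; bar_graph a x' y'\<rbrakk> \<Longrightarrow> bar_graph a (x + x') (y + y')"
| scale: "bar_graph a x y \<Longrightarrow> bar_graph a (scale c x) (scale (bar_coeff c) y)"

text \<open>\<open>is_canonical a mu x\<close> says that \<open>x\<close> is the canonical basis element \<open>G(mu)\<close>. By the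
  theory of global crystal bases there is exactly one such \<open>x\<close> for every e-regular \<open>mu\<close>.\<close>

definition is_canonical :: "nat \<Rightarrow> mpart \<Rightarrow> fock \<Rightarrow> bool" where
  "is_canonical a mu x \<longleftrightarrow> e_regular a mu \<and> x \<in> integral_form a \<and> bar_graph a x x \<and>
     Poly_Mapping.lookup x mu = 1 \<and>
     (\<forall>la. la \<noteq> mu \<longrightarrow> (\<exists>p\<in>int_polys. Poly_Mapping.lookup x la = v * p))"

text \<open>The coefficient of \<open>v\<close> to the power \<open>l\<close> in an integral polynomial in \<open>v\<close>.\<close>

definition v_coeff :: "qv \<Rightarrow> nat \<Rightarrow> int" where
  "v_coeff c l = coeff (THE p :: int poly. c = poly (map_poly of_int p) v) l"

text \<open>The shape of the canonical basis element \<open>x = G(mu)\<close>. A multipartition with coefficient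
  \<open>m v\<close>\<open>\<^sup>l\<close> is counted \<open>m\<close> times in position \<open>l\<close>.\<close>

definition shape :: "nat \<Rightarrow> mpart \<Rightarrow> fock \<Rightarrow> int list" where
  "shape a mu x = map (\<lambda>l. \<Sum>la\<in>Poly_Mapping.keys x. v_coeff (Poly_Mapping.lookup x la) l)
     [0..<Suc (nat (defect a (weight a mu)))]"

section \<open>Choice sequences and the multipartitions tau\<close>

definition choice_seqs :: "nat \<Rightarrow> nat \<Rightarrow> nat list set" where
  "choice_seqs c k = {S. length S = c \<and> set S \<subseteq> {0, 1} \<and> card {p. p < c \<and> S ! p = 1} = k}"

definition Inv :: "nat list \<Rightarrow> nat" where
  "Inv S = (\<Sum>p | p < length S \<and> S ! p = 1. card {q. q < p \<and> S ! q = 0})"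

text \<open>The staircase \<open>(n, n - 1, \<dots>, 1)\<close>, empty for \<open>n \<le> 0\<close>.\<close>

definition staircase :: "int \<Rightarrow> nat \<Rightarrow> nat" where
  "staircase n t = nat (n - int t)"

definition tau :: "nat \<Rightarrow> nat \<Rightarrow> nat \<Rightarrow> nat list \<Rightarrow> mpart" where
  "tau a i n S = (\<lambda>c.
     if 2 * a \<le> c then (\<lambda>t. 0)
     else if i * a \<le> c \<and> c < i * a + a then
       (if S ! (c - i * a) = 1 then staircase (int n + 1) else staircase (int n - 1))
     else staircase (int n))"

text \<open>The two arguments after the first are integers because the recursion also visits
  \<open>k = -1\<close> and negative \<open>l\<close>, where the value is 0. The value for \<open>a = 0\<close> is irrelevant.\<close>

fun s_num :: "nat \<Rightarrow> int \<Rightarrow> int \<Rightarrow> int" where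
  "s_num 0 k l = 0"
| "s_num (Suc 0) k l = (if (k = 0 \<or> k = 1) \<and> l = 0 then 1 else 0)"
| "s_num (Suc (Suc b)) k l =
     (if 0 \<le> l \<and> l \<le> k * (int (Suc (Suc b)) - k)
      then s_num (Suc b) (k - 1) l + s_num (Suc b) k (l - k) else 0)"

end

theory Submission
  imports Defs
begin

text \<open>
  Everything rests on one situation: a multipartition \<open>\<lambda>\<close> that has addable \<open>i\<close>-nodes but no removable ones.
  Since neighbouring positions have different residues, adding some of these nodes does not disturb the
  others. All powers of \<open>f\<^sub>i\<close> on \<open>\<lambda>\<close> and the whole \<open>i\<close>-string
  through \<open>\<lambda>\<close> can therefore be described by subsets of the set \<open>R\<close> of rows with an addable
  \<open>i\<close>-node.

  In the Fock space, the divided power \<open>f\<^sub>i\<^sup>(\<^sup>r\<^sup>)\<close> maps \<open>\<lambda>\<close> to the sum over the subsets \<open>B\<close> of size \<open>r\<close> of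
  \<open>v\<close> to the number of inversions of \<open>B\<close> in \<open>R\<close> times \<open>\<lambda>\<close> with \<open>B\<close> filled
  (\<open>divided_power_fill\<close>); the quantum factorial arises from the orders in which the nodes can be added.
  For \<open>r = |R|\<close> there is one term, with coefficient 1. In the crystal, the nodes are added
  from top to bottom (\<open>crystal_f_string_state\<close>), \<open>\<lambda>\<close> is the beginning of its string, and \<open>s\<^sub>i\<close> maps it to \<open>\<lambda>\<close>
  with all of \<open>R\<close> filled (\<open>crystal_s_fill\<close>).

  The empty multipartition is in this situation, with \<open>R\<close> consisting of \<open>a\<close> corners. Subsets of the corners are choice
  sequences with the same inversion number, so \<open>f\<^sub>i\<^sup>(\<^sup>k\<^sup>)\<close> applied to the vacuum is the claimed
  element for the empty word, and the topmost \<open>k\<close> corners give the only regular multipartition of weight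
  \<open>\<Lambda> - k \<alpha>\<^sub>i\<close>. Each \<open>tau a i n S\<close> is in this situation as well, for the
  residue \<open>i + n + 1\<close>, and filling all rows gives \<open>tau a i (n + 1) S\<close>. The number of rows is
  \<open>2 a n + a + 2 k\<close> for every \<open>S\<close>, so a single divided power takes the element for \<open>n\<close> to the one for \<open>n + 1\<close> and
  keeps the coefficients. A reduced word alternates between the generators, which is exactly the order of residues
  that occurs.

  The element so constructed is a monomial in divided powers applied to the vacuum, hence bar invariant and integral.
  Its coefficients are powers of \<open>v\<close>, with exponent 0 only for the sequence
  starting with all its ones, so it is canonical. Its shape counts choice sequences by inversions, which
  follows the stated recursion by removing the first entry; the length of the shape is correct because the defect keeps
  the value \<open>k (a - k)\<close> along the orbit.
\<close>

section \<open>Rational functions in v and the bar involution\<close>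

definition eval_at :: "qv \<Rightarrow> rat poly \<Rightarrow> qv" where
  "eval_at x p = poly (map_poly (\<lambda>r. to_fract [:r:]) p) x"

lemma eval_at_0 [simp]: "eval_at x 0 = 0"
  by (simp add: eval_at_def)

lemma eval_at_pCons [simp]: "eval_at x (pCons c p) = to_fract [:c:] + x * eval_at x p"
  by (simp add: eval_at_def map_poly_pCons)

lemma eval_at_add: "eval_at x (p + q) = eval_at x p + eval_at x q"
proof (induction p q rule: poly_induct2)
  case (pCons a p b q)
  have "to_fract [:a + b:] = to_fract [:a:] + to_fract [:b:]"
    by (subst to_fract_add[symmetric]) simp
  with pCons show ?case by (simp add: algebra_simps)
qed simp

lemma eval_at_smult: "eval_at x (smult c p) = to_fract [:c:] * eval_at x p"
proof (induction p)
  case (pCons a p)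
  have "to_fract [:c * a:] = to_fract [:c:] * to_fract [:a:]"
    by (subst to_fract_mult[symmetric]) simp
  with pCons show ?case by (simp add: algebra_simps)
qed simp

lemma eval_at_mult: "eval_at x (p * q) = eval_at x p * eval_at x q"
  by (induction p) (simp_all add: eval_at_add eval_at_smult algebra_simps)

lemma eval_at_v: "eval_at v p = to_fract p"
proof (induction p)
  case (pCons a p)
  have "pCons a p = [:a:] + [:0, 1:] * p" by simp
  then have "to_fract (pCons a p) = to_fract [:a:] + v * to_fract p"
    by (simp only: to_fract_add to_fract_mult v_def)
  with pCons show ?case by simp
qed simp

lemma v_nonzero [simp]: "v \<noteq> 0"
  by (simp add: v_def)

text \<open>Reversing the coefficients of a polynomial turns its value at the inverse of \<open>v\<close>
  into its value at \<open>v\<close>, up to a power of \<open>v\<close>. Since \<open>v\<close> is transcendental,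
  so is its inverse.\<close>

lemma eval_at_inverse_v_eq_0_iff [simp]: "eval_at (inverse v) p = 0 \<longleftrightarrow> p = 0"
proof
  let ?P = "map_poly (\<lambda>r. to_fract [:r:]) p"
  assume "eval_at (inverse v) p = 0"
  then have "poly (reflect_poly ?P) v = 0"
    by (simp add: poly_reflect_poly_nz eval_at_def)
  moreover have "reflect_poly ?P = map_poly (\<lambda>r. to_fract [:r:]) (reflect_poly p)"
    by (rule poly_eqI) (simp add: coeff_reflect_poly coeff_map_poly degree_map_poly)
  ultimately have "eval_at v (reflect_poly p) = 0"
    by (simp add: eval_at_def)
  then show "p = 0" by (simp add: eval_at_v)
qed simp

text \<open>Evaluation at the inverse of \<open>v\<close> is a ring homomorphism, so the quotient does not depend on the
  representation of the fraction. This makes \<open>bar_coeff\<close> a field homomorphism.\<close>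

lemma bar_coeff_Fract:
  assumes "q \<noteq> 0"
  shows "bar_coeff (Fract p q) = eval_at (inverse v) p / eval_at (inverse v) q"
proof -
  let ?p = "fst (quot_of_fract (Fract p q))" and ?q = "snd (quot_of_fract (Fract p q))"
  have "Fract ?p ?q = Fract p q" by (rule Fract_quot_of_fract)
  then have "?p * q = p * ?q" using assms by (simp add: eq_fract del: Fract_quot_of_fract)
  then have "eval_at (inverse v) ?p * eval_at (inverse v) q =
      eval_at (inverse v) p * eval_at (inverse v) ?q"
    by (simp flip: eval_at_mult)
  then have "eval_at (inverse v) ?p / eval_at (inverse v) ?q =
      eval_at (inverse v) p / eval_at (inverse v) q"
    using assms by (simp add: frac_eq_eq)
  then show ?thesis by (simp add: bar_coeff_def case_prod_unfold eval_at_def)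
qed

lemma bar_coeff_add: "bar_coeff (x + y) = bar_coeff x + bar_coeff y"
  by (cases x; cases y) (simp add: bar_coeff_Fract eval_at_add eval_at_mult add_frac_eq mult.commute)

lemma bar_coeff_mult: "bar_coeff (x * y) = bar_coeff x * bar_coeff y"
  by (cases x; cases y) (simp add: bar_coeff_Fract eval_at_mult)

lemma bar_coeff_0 [simp]: "bar_coeff 0 = 0"
  using bar_coeff_Fract[of 1 0] by (simp add: Zero_fract_def[symmetric])

lemma bar_coeff_1 [simp]: "bar_coeff 1 = 1"
  using bar_coeff_Fract[of 1 1] by (simp add: One_fract_def[symmetric])

lemma bar_coeff_v: "bar_coeff v = inverse v"
proof -
  have "v = Fract [:0, 1:] 1" by (simp add: v_def to_fract_def)
  moreover have "to_fract [:1 :: rat:] = 1" by (simp flip: one_pCons)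
  moreover have "eval_at (inverse v) 1 = 1"
    using \<open>to_fract [:1 :: rat:] = 1\<close> by (simp add: one_pCons)
  ultimately show ?thesis using bar_coeff_Fract[of 1 "[:0, 1:]"] by simp
qed

lemma bar_coeff_inverse: "bar_coeff (inverse x) = inverse (bar_coeff x)"
proof (cases "x = 0")
  case False
  then have "bar_coeff (inverse x) * bar_coeff x = 1"
    by (simp flip: bar_coeff_mult)
  then show ?thesis by (metis inverse_unique mult.commute)
qed simp

lemma bar_coeff_power: "bar_coeff (x ^ m) = bar_coeff x ^ m"
  by (induction m) (simp_all add: bar_coeff_mult)

lemma bar_coeff_v_powi: "bar_coeff (v powi m) = v powi (- m)"
  by (auto simp: power_int_def bar_coeff_power bar_coeff_inverse bar_coeff_v power_inverse)

lemma bar_coeff_sum: "bar_coeff (sum f A) = (\<Sum>x\<in>A. bar_coeff (f x))"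
  by (induction A rule: infinite_finite_induct) (simp_all add: bar_coeff_add)

lemma bar_coeff_prod: "bar_coeff (prod f A) = (\<Prod>x\<in>A. bar_coeff (f x))"
  by (induction A rule: infinite_finite_induct) (simp_all add: bar_coeff_mult)

text \<open>Inverting \<open>v\<close> reverses the order of the summands.\<close>

lemma bar_coeff_qint: "bar_coeff (qint m) = qint m"
  unfolding qint_def bar_coeff_sum bar_coeff_v_powi
  by (rule sum.reindex_bij_witness[where i = "\<lambda>j. m - 1 - j" and j = "\<lambda>j. m - 1 - j"])
    (auto simp: of_nat_diff algebra_simps)

lemma bar_coeff_inverse_qfact: "bar_coeff (1 / qfact m) = 1 / qfact m"
  by (simp add: qfact_def bar_coeff_inverse bar_coeff_prod bar_coeff_qint divide_inverse)

lemma v_power: "v ^ m = to_fract (monom 1 m)"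
  by (induction m) (simp_all add: v_def monom_Suc flip: to_fract_mult)

text \<open>Up to a power of \<open>v\<close>, the quantum integer is a polynomial whose value at
  1 is \<open>m\<close>.\<close>

lemma qint_nonzero:
  assumes "m > 0"
  shows "qint m \<noteq> 0"
proof
  assume "qint m = 0"
  let ?P = "\<Sum>j<m. monom 1 (2 * (m - 1 - j)) :: rat poly"
  have "to_fract ?P = (\<Sum>j<m. v ^ (2 * (m - 1 - j)))"
    by (simp add: v_power)
  also have "\<dots> = (\<Sum>j<m. v powi (int m - 1) * v powi (int m - 1 - 2 * int j))"
    by (rule sum.cong) (auto simp: of_nat_diff simp flip: power_int_of_nat power_int_add
        intro!: arg_cong[where f = "power_int v"])
  also have "\<dots> = v powi (int m - 1) * qint m"
    by (simp add: qint_def sum_distrib_left)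
  finally have "to_fract ?P = 0" using \<open>qint m = 0\<close> by simp
  then have "?P = 0" by (simp only: to_fract_eq_0_iff)
  then have "poly ?P 1 = 0" by simp
  then show False using assms by (simp add: poly_sum poly_monom)
qed

lemma qfact_nonzero: "qfact m \<noteq> 0"
  by (auto simp: qfact_def qint_nonzero)

lemma qfact_Suc: "qfact (Suc m) = qint (Suc m) * qfact m"
  by (simp add: qfact_def)

lemma poly_of_int_v: "poly (map_poly of_int p) v = to_fract (map_poly of_int p)"
proof -
  have "to_fract [:of_int z:] = (of_int z :: qv)" for z
    unfolding of_int_poly[symmetric] by (induction z rule: int_induct[where k = 0]) simp_all
  then have "map_poly of_int p = map_poly (\<lambda>r. to_fract [:r:]) (map_poly of_int p :: rat poly)"
    by (intro poly_eqI) (simp add: coeff_map_poly)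
  then show ?thesis using eval_at_v[of "map_poly of_int p"] by (simp add: eval_at_def)
qed

lemma v_power_eq_int_poly: "v ^ m = poly (map_poly of_int (monom 1 m)) v"
  unfolding poly_of_int_v v_power by (simp add: map_poly_monom)

lemma v_power_in_int_polys: "v ^ m \<in> int_polys"
  unfolding int_polys_def v_power_eq_int_poly by (rule rangeI)

lemma one_in_int_laurent_polys: "1 \<in> int_laurent_polys"
  using v_power_in_int_polys[of 0] unfolding int_laurent_polys_def
  by (intro CollectI exI[of _ 1] exI[of _ 0]) simp

text \<open>The polynomial in the definition of \<open>v_coeff\<close> is unique because \<open>v\<close> is transcendental.\<close>

lemma v_coeff_v_power: "v_coeff (v ^ m) l = (if l = m then 1 else 0)"
proof -
  have "(THE p :: int poly. v ^ m = poly (map_poly of_int p) v) = monom 1 m"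
  proof (rule the_equality)
    fix p :: "int poly"
    assume "v ^ m = poly (map_poly of_int p) v"
    then have "map_poly of_int p = (map_poly of_int (monom 1 m) :: rat poly)"
      unfolding v_power_eq_int_poly by (simp add: poly_of_int_v)
    then have "(of_int (coeff p j) :: rat) = of_int (coeff (monom 1 m) j)" for j
      by (metis coeff_map_poly of_int_0)
    then show "p = monom 1 m" by (auto intro: poly_eqI)
  qed (rule v_power_eq_int_poly)
  then show ?thesis by (simp add: v_coeff_def)
qed

section \<open>Linearity of the generators\<close>

lemma lookup_scale [simp]: "Poly_Mapping.lookup (scale c x) la = c * Poly_Mapping.lookup x la"
  by (simp add: scale_def Poly_Mapping.map.rep_eq when_def)

lemma scale_single [simp]: "scale c (Poly_Mapping.single la d) = Poly_Mapping.single la (c * d)"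
  by (rule poly_mapping_eqI) (simp add: lookup_single when_def)

lemma scale_scale [simp]: "scale c (scale d x) = scale (c * d) x"
  by (rule poly_mapping_eqI) simp

lemma scale_one [simp]: "scale 1 x = x"
  by (rule poly_mapping_eqI) simp

lemma scale_zero [simp]: "scale c 0 = 0"
  by (rule poly_mapping_eqI) simp

lemma scale_add: "scale c (x + y) = scale c x + scale c y"
  by (rule poly_mapping_eqI) (simp add: lookup_add algebra_simps)

lemma scale_sum: "scale c (sum f A) = (\<Sum>x\<in>A. scale c (f x))"
  by (induction A rule: infinite_finite_induct) (simp_all add: scale_add)

lemma single_sum: "Poly_Mapping.single la (sum f A) = (\<Sum>x\<in>A. Poly_Mapping.single la (f x))"
  by (induction A rule: infinite_finite_induct) (simp_all add: single_add)

text \<open>The sum in the definition runs over the support, which depends on the vector. A larger finite set gives the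
  same value and can be chosen for two vectors at once.\<close>

lemma fock_f_superset:
  assumes "finite A" and "Poly_Mapping.keys x \<subseteq> A"
  shows "fock_f a i x = (\<Sum>la\<in>A. \<Sum>n\<in>addable a i la.
     Poly_Mapping.single (add_node la n) (Poly_Mapping.lookup x la * v powi N_above a i la n))"
  unfolding fock_f_def
  by (rule sum.mono_neutral_left) (use assms in \<open>auto simp: in_keys_iff\<close>)

lemma fock_f_add: "fock_f a i (x + y) = fock_f a i x + fock_f a i y"
proof -
  let ?A = "Poly_Mapping.keys x \<union> Poly_Mapping.keys y"
  have fin: "finite ?A" by simp
  show ?thesis
    using fock_f_superset[OF fin, of x a i] fock_f_superset[OF fin, of y a i]
      fock_f_superset[OF fin keys_add[of x y], of a i]
    by (simp add: lookup_add distrib_right single_add sum.distrib)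
qed

lemma fock_f_zero [simp]: "fock_f a i 0 = 0"
  by (simp add: fock_f_def)

lemma fock_f_scale: "fock_f a i (scale c x) = scale c (fock_f a i x)"
proof -
  have "Poly_Mapping.keys (scale c x) \<subseteq> Poly_Mapping.keys x"
    by (auto simp: in_keys_iff)
  then show ?thesis
    by (simp add: fock_f_superset[of "Poly_Mapping.keys x"] scale_sum mult.assoc)
qed

lemma fock_f_sum: "fock_f a i (sum f A) = (\<Sum>x\<in>A. fock_f a i (f x))"
  by (induction A rule: infinite_finite_induct) (simp_all add: fock_f_add)

lemma fock_f_single: "fock_f a i (Poly_Mapping.single la c) =
    (\<Sum>n\<in>addable a i la. Poly_Mapping.single (add_node la n) (c * v powi N_above a i la n))"
  by (subst fock_f_superset[of "{la}"]) simp_all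

lemma divided_power_scale: "divided_power a i k (scale c x) = scale c (divided_power a i k x)"
proof -
  have "(fock_f a i ^^ k) (scale c x) = scale c ((fock_f a i ^^ k) x)"
    by (induction k) (simp_all add: fock_f_scale)
  then show ?thesis by (simp add: divided_power_def mult.commute)
qed

lemma divided_power_sum: "divided_power a i k (sum f A) = (\<Sum>x\<in>A. divided_power a i k (f x))"
proof -
  have "(fock_f a i ^^ k) (sum f A) = (\<Sum>x\<in>A. (fock_f a i ^^ k) (f x))"
    by (induction k) (simp_all add: fock_f_sum)
  then show ?thesis by (simp add: divided_power_def scale_sum)
qed

section \<open>Filling addable rows\<close>

text \<open>Several nodes of one residue, at most one in each row, are added at once. They are identified by their
  rows, ordered from top to bottom by the lexicographic order on pairs.\<close>

definition fill :: "mpart \<Rightarrow> (nat \<times> nat) set \<Rightarrow> mpart" where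
  "fill la B = (\<lambda>c t. la c t + (if (c, t) \<in> B then 1 else 0))"

definition row_end :: "mpart \<Rightarrow> nat \<times> nat \<Rightarrow> node" where
  "row_end la = (\<lambda>(c, t). (c, t, la c t))"

definition addable_rows :: "nat \<Rightarrow> nat \<Rightarrow> mpart \<Rightarrow> (nat \<times> nat) set" where
  "addable_rows a i la = {x. row_end la x \<in> addable a i la}"

text \<open>For \<open>B \<subseteq> R\<close> this is the number of pairs consisting of an element of \<open>B\<close> and a
  smaller element of \<open>R\<close> outside \<open>B\<close>; for the choice sequence that marks \<open>B\<close> in \<open>R\<close> it is
  the statistic \<open>Inv\<close>.\<close>

definition invs :: "'a::linorder set \<Rightarrow> 'a set \<Rightarrow> nat" where
  "invs R B = (\<Sum>b\<in>B. card {x \<in> R - B. x < b})"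

lemma fill_empty [simp]: "fill la {} = la"
  by (simp add: fill_def)

lemma inj_row_end: "inj_on (row_end la) A"
  by (auto simp: inj_on_def row_end_def)

lemma above_row_end: "above (row_end la x) (row_end mu y) \<longleftrightarrow> x < y"
  by (cases x; cases y) (auto simp: row_end_def less_prod_def')

lemma add_node_row_end:
  assumes "x \<notin> B"
  shows "add_node (fill la B) (row_end mu x) = fill la (insert x B)"
  using assms by (cases x) (auto simp: row_end_def fill_def fun_eq_iff)

lemma nat_mod_2_add_1: "nat ((x + 1) mod 2) \<noteq> nat (x mod 2)" for x :: int
  by (cases "even x") (simp_all add: even_iff_mod_2_eq_zero mod_add_eq[symmetric] not_mod_2_eq_0_eq_1)

lemma residue_Suc_column: "residue a (c, t, Suc u) \<noteq> residue a (c, t, u)"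
  using nat_mod_2_add_1[of "(if c < a then 0 else 1) + int u - int t"]
  by (simp add: algebra_simps)

lemma residue_Suc_row: "residue a (c, Suc t, u) \<noteq> residue a (c, t, u)"
  using nat_mod_2_add_1[of "(if c < a then 0 else 1) + int u - int (Suc t)"]
  by (simp add: algebra_simps)
definition rows_decreasing :: "mpart \<Rightarrow> bool" where
  "rows_decreasing la \<longleftrightarrow> (\<forall>c t. la c (Suc t) \<le> la c t)"

text \<open>Without removable \<open>i\<close>-nodes, a multipartition is the beginning of its \<open>i\<close>-string. The two conditions on
  rows hold for all multipartitions, but not for arbitrary functions of this type.\<close>

definition string_source :: "nat \<Rightarrow> nat \<Rightarrow> mpart \<Rightarrow> bool" where
  "string_source a i la \<longleftrightarrow> rows_decreasing la \<and> finite (addable_rows a i la) \<and>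
     removable a i la = {}"

text \<open>Neighbouring positions of a row or of a column have different residues. The positions next to an added
  node of residue \<open>i\<close> are therefore no \<open>i\<close>-nodes, and filling rows neither changes the
  addability of the other \<open>i\<close>-nodes nor creates new ones.\<close>

lemma addable_fill:
  assumes "rows_decreasing la" and "B \<subseteq> addable_rows a i la"
  shows "addable a i (fill la B) = row_end la ` (addable_rows a i la - B)"
proof (intro set_eqI iffI)
  fix n assume n: "n \<in> addable a i (fill la B)"
  obtain c t u where [simp]: "n = (c, t, u)" by (cases n)
  have B: "residue a (c', t', la c' t') = i" if "(c', t') \<in> B" for c' t'
    using that assms(2) by (auto simp: addable_rows_def row_end_def addable_def)
  from n have r: "residue a (c, t, u) = i" and u: "u = fill la B c t"
    by (auto simp: addable_def)
  have notB: "(c, t) \<notin> B"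
  proof
    assume ct: "(c, t) \<in> B"
    then have "u = Suc (la c t)" by (simp add: u fill_def)
    then show False using residue_Suc_column r B[OF ct] by metis
  qed
  then have u': "u = la c t" by (simp add: u fill_def)
  have "t = 0 \<or> la c t < la c (t - 1)"
  proof (rule ccontr)
    assume no: "\<not> ?thesis"
    then obtain s where t: "t = Suc s" by (cases t) auto
    have "la c t \<le> la c s" using assms(1) by (simp add: t rows_decreasing_def)
    with no t have eq: "la c s = la c t" by simp
    have "fill la B c t < fill la B c s" using n t by (auto simp: addable_def)
    then have "(c, s) \<in> B" using eq notB by (auto simp: fill_def split: if_splits)
    from B[OF this] have "residue a (c, s, u) = i" by (simp add: eq u')
    with r show False using residue_Suc_row t by metis
  qed
  then have "(c, t) \<in> addable_rows a i la"
    using n u u' by (auto simp: addable_rows_def row_end_def addable_def)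
  with notB u' show "n \<in> row_end la ` (addable_rows a i la - B)"
    by (intro image_eqI[of _ _ "(c, t)"]) (simp_all add: row_end_def)
next
  fix n assume "n \<in> row_end la ` (addable_rows a i la - B)"
  then obtain c t where ct: "(c, t) \<in> addable_rows a i la" "(c, t) \<notin> B" and n: "n = (c, t, la c t)"
    by (auto simp: row_end_def)
  then show "n \<in> addable a i (fill la B)"
    by (auto simp: addable_rows_def row_end_def addable_def fill_def)
qed

lemma removable_fill:
  assumes "string_source a i la" and "B \<subseteq> addable_rows a i la"
  shows "removable a i (fill la B) = row_end la ` B"
proof (intro set_eqI iffI)
  fix n assume n: "n \<in> removable a i (fill la B)"
  obtain c t u where [simp]: "n = (c, t, u)" by (cases n)
  have "(c, t) \<in> B"
  proof (rule ccontr)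
    assume no: "(c, t) \<notin> B"
    then have "(c, t, u) \<in> removable a i la"
      using n by (auto simp: removable_def fill_def split: if_splits)
    then show False using assms(1) by (auto simp: string_source_def)
  qed
  moreover from this have "u = la c t" using n by (auto simp: removable_def fill_def)
  ultimately show "n \<in> row_end la ` B"
    by (intro image_eqI[of _ _ "(c, t)"]) (simp_all add: row_end_def)
next
  fix n assume "n \<in> row_end la ` B"
  then obtain c t where ct: "(c, t) \<in> B" and n: "n = (c, t, la c t)"
    by (auto simp: row_end_def)
  from ct assms(2) have c: "c < 2 * a" and r: "residue a (c, t, la c t) = i"
    by (auto simp: addable_rows_def row_end_def addable_def)
  have "la c (Suc t) \<le> la c t"
    using assms(1) by (auto simp: string_source_def rows_decreasing_def)
  moreover have "la c (Suc t) < la c t" if "(c, Suc t) \<in> B"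
    using that assms(2) by (auto simp: addable_rows_def row_end_def addable_def)
  ultimately have "fill la B c (Suc t) < fill la B c t"
    using ct by (auto simp: fill_def)
  then show "n \<in> removable a i (fill la B)"
    using ct n c r by (auto simp: removable_def fill_def)
qed

lemma N_above_fill:
  assumes "string_source a i la" and "B \<subseteq> addable_rows a i la"
  shows "N_above a i (fill la B) (row_end la x) =
     int (card {y \<in> addable_rows a i la - B. y < x}) - int (card {y \<in> B. y < x})"
proof -
  have *: "card {m \<in> row_end la ` A. above m (row_end la x)} = card {y \<in> A. y < x}" for A
  proof -
    have "{m \<in> row_end la ` A. above m (row_end la x)} = row_end la ` {y \<in> A. y < x}"
      by (auto simp: above_row_end)
    then show ?thesis by (simp add: card_image[OF inj_row_end])
  qed
  show ?thesis
    using assms addable_fill[OF _ assms(2)] removable_fill[OF assms]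
    by (simp add: N_above_def * string_source_def)
qed

section \<open>Powers of a generator\<close>

lemma card_less_sorted_list_of_set:
  fixes C :: "'a::linorder set"
  assumes "finite C" and "p < card C"
  shows "card {y \<in> C. y < sorted_list_of_set C ! p} = p"
    and "card {y \<in> C. sorted_list_of_set C ! p < y} = card C - 1 - p"
proof -
  let ?xs = "sorted_list_of_set C"
  have len: "length ?xs = card C" by simp
  have strict: "?xs ! q < ?xs ! r \<longleftrightarrow> q < r" if "q < card C" "r < card C" for q r
    using that sorted_wrt_nth_less[of "(<)" ?xs q r] sorted_wrt_nth_less[of "(<)" ?xs r q]
      strict_sorted_list_of_set[of C] len
    by (metis linorder_neqE_nat order_less_asym order_less_irrefl)
  have C: "C = (!) ?xs ` {..<card C}"
    using assms(1) bij_betw_nth[of ?xs "{..<card C}" C] by (simp add: bij_betw_def)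
  have inj: "inj_on ((!) ?xs) A" if "A \<subseteq> {..<card C}" for A
    using that by (intro inj_on_nth) auto
  have "{y \<in> C. y < ?xs ! p} = (!) ?xs ` {..<p}"
    using strict assms(2) by (subst C) auto
  then show "card {y \<in> C. y < ?xs ! p} = p"
    using assms(2) by (simp add: card_image inj subset_iff)
  have "{y \<in> C. ?xs ! p < y} = (!) ?xs ` {p<..<card C}"
    using strict assms(2) by (subst C) auto
  then show "card {y \<in> C. ?xs ! p < y} = card C - 1 - p"
    using assms(2) by (simp add: card_image inj subset_iff)
qed

text \<open>The element at position \<open>p\<close> of \<open>C\<close> has \<open>p\<close> smaller and \<open>m - 1 - p\<close> larger
  elements, where \<open>m\<close> is the size of \<open>C\<close>.\<close>

lemma sum_v_powi_position:
  fixes C :: "'a::linorder set"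
  assumes "finite C"
  shows "(\<Sum>x\<in>C. v powi (int (card {y \<in> C. x < y}) - int (card {y \<in> C. y < x}))) = qint (card C)"
proof -
  let ?xs = "sorted_list_of_set C"
  have "bij_betw ((!) ?xs) {..<card C} C"
    using assms bij_betw_nth[of ?xs "{..<card C}" C] by simp
  then have "(\<Sum>x\<in>C. v powi (int (card {y \<in> C. x < y}) - int (card {y \<in> C. y < x}))) =
     (\<Sum>p<card C. v powi (int (card {y \<in> C. ?xs ! p < y}) - int (card {y \<in> C. y < ?xs ! p})))"
    by (rule sum.reindex_bij_betw[symmetric])
  also have "\<dots> = qint (card C)"
    unfolding qint_def
    by (rule sum.cong) (auto simp: card_less_sorted_list_of_set assms of_nat_diff algebra_simps)
  finally show ?thesis .
qed

text \<open>Moving \<open>x\<close> from \<open>C\<close> to its complement destroys the inversions of \<open>x\<close> with smaller elements and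
  creates one with each larger element of \<open>C\<close>.\<close>

lemma invs_remove:
  fixes C :: "'a::linorder set"
  assumes "finite R" and "C \<subseteq> R" and "x \<in> C"
  shows "invs R (C - {x}) + card {y \<in> R - (C - {x}). y < x} = invs R C + card {y \<in> C. x < y}"
proof -
  let ?B = "C - {x}"
  have fin: "finite C" using assms finite_subset by blast
  have compl: "R - ?B = insert x (R - C)" using assms by blast
  have below: "{y \<in> R - ?B. y < x} = {y \<in> R - C. y < x}" using compl by auto
  have "card {y \<in> R - ?B. y < b} = card {y \<in> R - C. y < b} + (if x < b then 1 else 0)" for b
  proof (cases "x < b")
    case True
    then have "{y \<in> R - ?B. y < b} = insert x {y \<in> R - C. y < b}" using compl by auto
    then show ?thesis using True assms by simp
  next
    case False
    then have "{y \<in> R - ?B. y < b} = {y \<in> R - C. y < b}" using compl by auto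
    then show ?thesis using False by simp
  qed
  then have "invs R ?B = (\<Sum>b\<in>?B. card {y \<in> R - C. y < b}) + (\<Sum>b\<in>?B. if x < b then 1 else 0)"
    by (simp add: invs_def sum.distrib)
  also have "(\<Sum>b\<in>?B. if x < b then 1 else 0) = card {y \<in> C. x < y}"
  proof -
    have "?B \<inter> {b. x < b} = {y \<in> C. x < y}" by auto
    then show ?thesis using fin by (simp add: sum.If_cases)
  qed
  finally show ?thesis
    unfolding below using fin assms(3) by (simp add: invs_def sum.remove)
qed

text \<open>The nodes of a set \<open>C\<close> of rows can be added in any order. Grouping the orders by the
  node added last, the exponent of \<open>v\<close> for last node \<open>x\<close> differs from the number of inversions of
  \<open>C\<close> by the number of elements of \<open>C\<close> below \<open>x\<close> minus the number above, and
  summing over \<open>x\<close> gives the next quantum integer.\<close>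

lemma fock_f_power_fill:
  assumes "string_source a i la"
  defines "R \<equiv> addable_rows a i la"
  shows "(fock_f a i ^^ r) (Poly_Mapping.single la 1) =
    (\<Sum>B | B \<subseteq> R \<and> card B = r. Poly_Mapping.single (fill la B) (qfact r * v ^ invs R B))"
proof (induction r)
  have finR: "finite R" using assms by (simp add: string_source_def)
  case 0
  have "{B. B \<subseteq> R \<and> card B = 0} = {{}}"
    using finR finite_subset by fastforce
  then show ?case by (simp add: invs_def qfact_def)
next
  case (Suc r)
  have finR: "finite R" using assms by (simp add: string_source_def)
  have finB: "finite B" if "B \<subseteq> R" for B using that finR finite_subset by blast
  let ?P = "\<lambda>r. {B. B \<subseteq> R \<and> card B = r}"
  let ?e = "\<lambda>B x. int (invs R B) + (int (card {y \<in> R - B. y < x}) - int (card {y \<in> B. y < x}))"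
  have step: "fock_f a i (Poly_Mapping.single (fill la B) (qfact r * v ^ invs R B)) =
      (\<Sum>x\<in>R - B. Poly_Mapping.single (fill la (insert x B)) (qfact r * v powi ?e B x))"
    if "B \<in> ?P r" for B
  proof -
    have B: "B \<subseteq> addable_rows a i la" using that by (simp add: R_def)
    have "addable a i (fill la B) = row_end la ` (R - B)"
      using assms(1) addable_fill[OF _ B] by (simp add: R_def string_source_def)
    then have "fock_f a i (Poly_Mapping.single (fill la B) (qfact r * v ^ invs R B)) =
      (\<Sum>x\<in>R - B. Poly_Mapping.single (add_node (fill la B) (row_end la x))
         (qfact r * v ^ invs R B * v powi N_above a i (fill la B) (row_end la x)))"
      by (simp add: fock_f_single sum.reindex[OF inj_row_end] o_def)
    also have "\<dots> = (\<Sum>x\<in>R - B. Poly_Mapping.single (fill la (insert x B)) (qfact r * v powi ?e B x))"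
      by (rule sum.cong) (simp_all add: add_node_row_end N_above_fill[OF assms(1) B] power_int_add
          mult.assoc flip: R_def)
    finally show ?thesis .
  qed
  have exponent: "?e (C - {x}) x = int (invs R C) +
      (int (card {y \<in> C. x < y}) - int (card {y \<in> C. y < x}))"
    if "C \<subseteq> R" "x \<in> C" for C x
  proof -
    have "{y \<in> C - {x}. y < x} = {y \<in> C. y < x}" by auto
    then show ?thesis using invs_remove[OF finR that] by simp
  qed
  have "(fock_f a i ^^ Suc r) (Poly_Mapping.single la 1) =
      (\<Sum>B\<in>?P r. \<Sum>x\<in>R - B.
        Poly_Mapping.single (fill la (insert x B)) (qfact r * v powi ?e B x))"
    using step by (simp add: Suc fock_f_sum)
  also have "\<dots> = (\<Sum>(B, x)\<in>Sigma (?P r) (\<lambda>B. R - B).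
        Poly_Mapping.single (fill la (insert x B)) (qfact r * v powi ?e B x))"
    using finR by (subst sum.Sigma) auto
  \<comment> \<open>Sum over the set of all nodes added and the one added last instead of the set before the last
    addition and the last node.\<close>
  also have "\<dots> = (\<Sum>(C, x)\<in>Sigma (?P (Suc r)) (\<lambda>C. C).
        Poly_Mapping.single (fill la C) (qfact r * v powi ?e (C - {x}) x))"
  proof (rule sum.reindex_bij_witness[where i = "\<lambda>(C, x). (C - {x}, x)"
        and j = "\<lambda>(B, x). (insert x B, x)"])
    show "(case Bx of (B, x) \<Rightarrow> (insert x B, x)) \<in> Sigma (?P (Suc r)) (\<lambda>C. C)"
      if "Bx \<in> Sigma (?P r) (\<lambda>B. R - B)" for Bx
      using that finB by (auto simp: card_insert_if)
    show "(case Cx of (C, x) \<Rightarrow> (C - {x}, x)) \<in> Sigma (?P r) (\<lambda>B. R - B)"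
      if "Cx \<in> Sigma (?P (Suc r)) (\<lambda>C. C)" for Cx
      using that finB by auto
    fix Bx assume Bx: "Bx \<in> Sigma (?P r) (\<lambda>B. R - B)"
    obtain B x where Bx_eq: "Bx = (B, x)" by (cases Bx)
    have "insert x B - {x} = B" using Bx by (simp add: Bx_eq)
    then show "(case (case Bx of (B, x) \<Rightarrow> (insert x B, x)) of (C, x) \<Rightarrow>
          Poly_Mapping.single (fill la C) (qfact r * v powi ?e (C - {x}) x)) =
        (case Bx of (B, x) \<Rightarrow>
          Poly_Mapping.single (fill la (insert x B)) (qfact r * v powi ?e B x))"
      by (simp only: Bx_eq prod.case)
  qed (auto simp: insert_absorb)
  also have "\<dots> = (\<Sum>C\<in>?P (Suc r). \<Sum>x\<in>C.
        Poly_Mapping.single (fill la C) (qfact r * v powi ?e (C - {x}) x))"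
    using finR finB by (subst sum.Sigma) auto
  also have "\<dots> = (\<Sum>C\<in>?P (Suc r).
        Poly_Mapping.single (fill la C) (qfact (Suc r) * v ^ invs R C))"
  proof (rule sum.cong)
    fix C assume C: "C \<in> ?P (Suc r)"
    have "(\<Sum>x\<in>C. qfact r * v powi ?e (C - {x}) x) =
        (\<Sum>x\<in>C. qfact r * v ^ invs R C *
          v powi (int (card {y \<in> C. x < y}) - int (card {y \<in> C. y < x})))"
    proof (rule sum.cong)
      fix x assume "x \<in> C"
      with C exponent[of C x] show "qfact r * v powi ?e (C - {x}) x = qfact r * v ^ invs R C *
          v powi (int (card {y \<in> C. x < y}) - int (card {y \<in> C. y < x}))"
        by (simp only: mem_Collect_eq power_int_add v_nonzero power_int_of_nat mult.assoc simp_thms)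
    qed simp
    also have "\<dots> = qfact (Suc r) * v ^ invs R C"
      using C finB by (simp add: sum_v_powi_position qfact_Suc flip: sum_distrib_left)
    finally show "(\<Sum>x\<in>C. Poly_Mapping.single (fill la C) (qfact r * v powi ?e (C - {x}) x)) =
        Poly_Mapping.single (fill la C) (qfact (Suc r) * v ^ invs R C)"
      by (simp flip: single_sum)
  qed simp
  finally show ?case .
qed

lemma divided_power_fill:
  assumes "string_source a i la"
  defines "R \<equiv> addable_rows a i la"
  shows "divided_power a i r (Poly_Mapping.single la 1) =
    (\<Sum>B | B \<subseteq> R \<and> card B = r. Poly_Mapping.single (fill la B) (v ^ invs R B))"
  using fock_f_power_fill[OF assms(1)] qfact_nonzero[of r]
  by (simp add: divided_power_def scale_sum R_def)

text \<open>Only one set of rows has full size, and it has no inversions.\<close>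

lemma divided_power_fill_all:
  assumes "string_source a i la"
  defines "R \<equiv> addable_rows a i la"
  shows "divided_power a i (card R) (Poly_Mapping.single la 1) = Poly_Mapping.single (fill la R) 1"
proof -
  have "finite R" using assms by (simp add: string_source_def)
  then have "{B. B \<subseteq> R \<and> card B = card R} = {R}"
    using card_subset_eq by blast
  then show ?thesis
    using divided_power_fill[OF assms(1), of "card R"] by (simp add: invs_def flip: R_def)
qed

section \<open>Crystal strings\<close>

lemma cancel_plus_minus:
  "cancel (map (\<lambda>x. (True, f x)) xs @ map (\<lambda>y. (False, g y)) ys) =
     map (\<lambda>x. (True, f x)) xs @ map (\<lambda>y. (False, g y)) ys"
proof (induction xs)
  case Nil
  show ?case
  proof (induction ys)
    case (Cons y ys)
    then show ?case by (cases ys) simp_all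
  qed simp
qed (simp add: Let_def)

lemma set_cancel: "set (cancel w) \<subseteq> set w"
proof (induction w)
  case (Cons x w)
  have "set (tl (cancel w)) \<subseteq> set (cancel w)" by (cases "cancel w") auto
  with Cons show ?case by (auto simp: Let_def)
qed simp

lemma crystal_f_SomeE:
  assumes "crystal_f a i la = Some mu"
  obtains n where "n \<in> addable a i la" and "mu = add_node la n"
proof -
  let ?ps = "filter fst (cancel (signature a i la))"
  have ps: "?ps \<noteq> []" and mu: "mu = add_node la (snd (last ?ps))"
    using assms by (auto simp: crystal_f_def Let_def split: if_splits)
  from last_in_set[OF ps] have "fst (last ?ps)" and "last ?ps \<in> set (signature a i la)"
    using set_cancel by auto
  then have "snd (last ?ps) \<in> addable a i la"
    by (auto simp: signature_def)
  with mu that show thesis by blast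
qed

definition string_state :: "nat \<Rightarrow> nat \<Rightarrow> mpart \<Rightarrow> nat \<Rightarrow> mpart" where
  "string_state a i la r = fill la (set (take r (sorted_list_of_set (addable_rows a i la))))"

lemma string_state_0 [simp]: "string_state a i la 0 = la"
  by (simp add: string_state_def)

lemma string_state_all:
  assumes "finite (addable_rows a i la)"
  shows "string_state a i la (card (addable_rows a i la)) = fill la (addable_rows a i la)"
  using assms by (simp add: string_state_def)

lemma sorted_list_of_row_ends:
  assumes "finite R"
  shows "sorted_list_of_set (row_end la ` R) = map (row_end la) (sorted_list_of_set R)"
proof (rule strict_sorted_equal)
  have "row_end la x < row_end la y" if "x < y" for x y
    using that by (cases x; cases y) (auto simp: row_end_def)
  then show "sorted_wrt (<) (map (row_end la) (sorted_list_of_set R))"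
    using sorted_wrt_mono_rel[OF _ strict_sorted_list_of_set[of R]] by (simp add: sorted_wrt_map)
qed (use assms in auto)

text \<open>The nodes added so far are the topmost ones, so the signature, read from bottom to top, is a
  block of + followed by a block of -. Nothing cancels in it.\<close>

lemma signature_string_state:
  assumes "string_source a i la"
  defines "rs \<equiv> sorted_list_of_set (addable_rows a i la)"
  shows "signature a i (string_state a i la r) =
    map (\<lambda>x. (True, row_end la x)) (rev (drop r rs)) @
    map (\<lambda>x. (False, row_end la x)) (rev (take r rs))"
proof -
  let ?R = "addable_rows a i la" and ?B = "set (take r rs)"
  have fin: "finite ?R" using assms(1) by (simp add: string_source_def)
  have set_rs: "set rs = ?R" and dist: "distinct rs" using fin by (simp_all add: rs_def)
  have B: "?B \<subseteq> ?R" using set_rs set_take_subset by metis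
  have st: "string_state a i la r = fill la ?B" by (simp add: string_state_def rs_def)
  have split: "set rs = ?B \<union> set (drop r rs)" by (metis append_take_drop_id set_append)
  have disj: "?B \<inter> set (drop r rs) = {}"
    using dist by (metis append_take_drop_id distinct_append)
  have add: "addable a i (fill la ?B) = row_end la ` set (drop r rs)"
    using addable_fill[OF _ B] assms(1) split disj set_rs
    by (simp add: string_source_def) (metis Diff_cancel Un_Diff Int_Un_eq(1) Diff_triv Un_empty_left inf_commute)
  have rem: "removable a i (fill la ?B) = row_end la ` ?B"
    by (rule removable_fill[OF assms(1) B])
  have "addable a i (fill la ?B) \<union> removable a i (fill la ?B) = row_end la ` ?R"
    using add rem split set_rs by blast
  then have "signature a i (fill la ?B) =
      map (\<lambda>x. (row_end la x \<in> row_end la ` set (drop r rs), row_end la x)) (rev rs)"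
    using fin by (simp add: signature_def sorted_list_of_row_ends add rev_map o_def flip: rs_def)
  also have "rev rs = rev (drop r rs) @ rev (take r rs)"
    by (metis append_take_drop_id rev_append)
  also have "map (\<lambda>x. (row_end la x \<in> row_end la ` set (drop r rs), row_end la x)) \<dots> =
      map (\<lambda>x. (True, row_end la x)) (rev (drop r rs)) @
      map (\<lambda>x. (False, row_end la x)) (rev (take r rs))"
    using disj by (auto simp: inj_image_mem_iff[OF inj_row_end] map_eq_conv)
  finally show ?thesis by (simp add: st)
qed

lemma crystal_f_string_state:
  assumes "string_source a i la"
  shows "r < card (addable_rows a i la) \<Longrightarrow>
      crystal_f a i (string_state a i la r) = Some (string_state a i la (Suc r))"
    and "crystal_f a i (string_state a i la (card (addable_rows a i la))) = None"
proof -
  let ?rs = "sorted_list_of_set (addable_rows a i la)"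
  have fin: "finite (addable_rows a i la)" using assms by (simp add: string_source_def)
  have ps: "filter fst (cancel (signature a i (string_state a i la r))) =
      map (\<lambda>x. (True, row_end la x)) (rev (drop r ?rs))" for r
    unfolding signature_string_state[OF assms] cancel_plus_minus
    by (simp add: filter_map o_def)
  show "crystal_f a i (string_state a i la (card (addable_rows a i la))) = None"
    using fin by (simp add: crystal_f_def ps)
  assume r: "r < card (addable_rows a i la)"
  then have "last (map (\<lambda>x. (True, row_end la x)) (rev (drop r ?rs))) = (True, row_end la (?rs ! r))"
    by (simp add: last_map last_rev hd_drop_conv_nth)
  moreover have "?rs ! r \<notin> set (take r ?rs)"
    using r by (auto simp: in_set_conv_nth nth_eq_iff_index_eq)
  moreover have "set (take (Suc r) ?rs) = insert (?rs ! r) (set (take r ?rs))"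
    using r by (simp add: take_Suc_conv_app_nth)
  ultimately show "crystal_f a i (string_state a i la r) = Some (string_state a i la (Suc r))"
    using r by (simp add: crystal_f_def ps) (simp add: string_state_def add_node_row_end)
qed

section \<open>Regular multipartitions\<close>

lemma addable_eq_row_end:
  assumes "n \<in> addable a i la"
  obtains x where "x \<in> addable_rows a i la" and "n = row_end la x" and "add_node la n = fill la {x}"
proof -
  obtain c t where n: "n = row_end la (c, t)"
    using assms by (cases n) (auto simp: addable_def row_end_def)
  moreover from this have "add_node la n = fill la {(c, t)}"
    using add_node_row_end[of "(c, t)" "{}" la la] by simp
  ultimately show thesis using assms that[of "(c, t)"] by (simp add: addable_rows_def)
qed

lemma nodes_fill: "nodes (fill la B) = nodes la \<union> row_end la ` B"
proof (rule set_eqI)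
  fix n :: node
  obtain c t u where n: "n = (c, t, u)" by (cases n)
  have "n \<in> row_end la ` B \<longleftrightarrow> (c, t) \<in> B \<and> u = la c t"
    by (force simp: n row_end_def)
  then show "n \<in> nodes (fill la B) \<longleftrightarrow> n \<in> nodes la \<union> row_end la ` B"
    by (auto simp: n nodes_def fill_def)
qed

text \<open>The added nodes all have residue \<open>i\<close> and are not nodes of the old multipartition.\<close>

lemma card_residue_fill:
  assumes "finite (nodes la)" and "finite B" and "B \<subseteq> addable_rows a i la"
  shows "card {n \<in> nodes (fill la B). residue a n = j} =
    card {n \<in> nodes la. residue a n = j} + (if j = i then card B else 0)"
proof -
  have res: "residue a n = i" if "n \<in> row_end la ` B" for n
    using that assms(3) by (auto simp: addable_rows_def addable_def)
  then have "{n \<in> nodes (fill la B). residue a n = j} =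
      {n \<in> nodes la. residue a n = j} \<union> (if j = i then row_end la ` B else {})"
    by (auto simp: nodes_fill)
  moreover have "nodes la \<inter> row_end la ` B = {}"
    by (auto simp: nodes_def row_end_def)
  then have "{n \<in> nodes la. residue a n = j} \<inter> (if j = i then row_end la ` B else {}) = {}"
    by auto
  moreover have "finite {n \<in> nodes la. residue a n = j}" using assms(1) by simp
  ultimately show ?thesis
    using assms(2) by (simp add: card_Un_disjoint card_image[OF inj_row_end])
qed

lemma e_regular_rows_nodes:
  assumes "e_regular a la"
  shows "rows_decreasing la \<and> finite (nodes la)"
  using assms
proof induction
  case empty
  have "nodes empty_mpart = {}" by (auto simp: nodes_def empty_mpart_def)
  then show ?case by (simp add: rows_decreasing_def empty_mpart_def)
next
  case (step la i mu)
  from step.hyps(3) obtain n where n: "n \<in> addable a i la" "mu = add_node la n"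
    by (rule crystal_f_SomeE)
  then obtain x where x: "x \<in> addable_rows a i la" and mu: "mu = fill la {x}"
    using addable_eq_row_end by metis
  have "mu c (Suc t) \<le> mu c t" for c t
  proof -
    have "la c (Suc t) \<le> la c t" using step.IH by (simp add: rows_decreasing_def)
    moreover have "la c (Suc t) < la c t" if "x = (c, Suc t)"
      using x that by (auto simp: addable_rows_def addable_def row_end_def)
    ultimately show ?thesis by (auto simp: mu fill_def)
  qed
  then show ?case using step.IH by (simp add: rows_decreasing_def mu nodes_fill)
qed

lemma crystal_f_removable:
  assumes "rows_decreasing la" and "crystal_f a i la = Some mu"
  shows "removable a i mu \<noteq> {}"
proof -
  from assms(2) obtain n where n: "n \<in> addable a i la" and mu: "mu = add_node la n"
    by (rule crystal_f_SomeE)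
  obtain c t u where [simp]: "n = (c, t, u)" by (cases n)
  have "la c (Suc t) \<le> la c t" using assms(1) by (simp add: rows_decreasing_def)
  then have "n \<in> removable a i mu"
    using n by (auto simp: mu removable_def addable_def)
  then show ?thesis by blast
qed

lemma e_regular_string_state:
  assumes "e_regular a la" and "string_source a i la" and "i < 2" and "r \<le> card (addable_rows a i la)"
  shows "e_regular a (string_state a i la r)"
  using assms(4)
proof (induction r)
  case (Suc r)
  then show ?case
    using e_regular.step[OF _ assms(3) crystal_f_string_state(1)[OF assms(2)]] by simp
qed (simp add: assms(1))

text \<open>A multipartition without removable \<open>i\<close>-nodes begins its \<open>i\<close>-string, because an application of the
  crystal operator creates a removable node. The string is therefore determined from there on.\<close>

lemma crystal_s_fill:
  assumes reg: "e_regular a la" and "i < 2" and la: "string_source a i la"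
  defines "R \<equiv> addable_rows a i la"
  shows "crystal_s a i la = fill la R"
  unfolding crystal_s_def
proof (rule the_equality)
  let ?st = "string_state a i la"
  let ?ms = "map ?st [0..<Suc (card R)]"
  have full: "?st (card R) = fill la R"
    using la string_state_all[of a i la] by (simp add: R_def string_source_def)
  have start: "\<not> (e_regular a nu \<and> crystal_f a i nu = Some la)" for nu
    using crystal_f_removable[of nu a i la] e_regular_rows_nodes[of a nu] la
    by (auto simp: string_source_def)
  have "is_string a i ?ms"
    unfolding is_string_def
  proof (intro conjI ballI allI impI)
    show "e_regular a nu" if "nu \<in> set ?ms" for nu
      using that e_regular_string_state[OF reg la \<open>i < 2\<close>] by (auto simp: R_def less_Suc_eq_le simp del: upt_Suc)
    show "crystal_f a i (?ms ! j) = Some (?ms ! Suc j)" if "Suc j < length ?ms" for j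
      using that crystal_f_string_state(1)[OF la, of j] by (simp add: R_def nth_append del: upt_Suc)
    show "crystal_f a i (last ?ms) = None"
      using crystal_f_string_state(2)[OF la] by (simp add: R_def)
    show "\<not> (\<exists>nu. e_regular a nu \<and> crystal_f a i nu = Some (hd ?ms))"
      using start by (simp add: hd_map del: upt_Suc)
  qed simp
  then show "\<exists>ms j. is_string a i ms \<and> j < length ms \<and> ms ! j = la \<and>
      ms ! (length ms - 1 - j) = fill la R"
    by (intro exI[of _ ?ms] exI[of _ 0]) (simp add: full del: upt_Suc)
next
  let ?st = "string_state a i la"
  have full: "?st (card R) = fill la R"
    using la string_state_all[of a i la] by (simp add: R_def string_source_def)
  fix mu assume "\<exists>ms j. is_string a i ms \<and> j < length ms \<and> ms ! j = la \<and>
    ms ! (length ms - 1 - j) = mu"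
  then obtain ms j where ms: "is_string a i ms" and j: "j < length ms" "ms ! j = la"
    and mu: "ms ! (length ms - 1 - j) = mu" by blast
  have next_state: "crystal_f a i (ms ! r) = Some (ms ! Suc r)" if "Suc r < length ms" for r
    using ms that by (simp add: is_string_def)
  have "j = 0"
  proof (rule ccontr)
    assume "j \<noteq> 0"
    then obtain j' where j': "j = Suc j'" by (cases j) auto
    then have "crystal_f a i (ms ! j') = Some la" using j next_state[of j'] by simp
    moreover have "rows_decreasing (ms ! j')"
      using ms j j' e_regular_rows_nodes[of a "ms ! j'"] nth_mem[of j' ms] by (simp add: is_string_def)
    ultimately show False
      using crystal_f_removable la by (auto simp: string_source_def)
  qed
  \<comment> \<open>From \<open>la\<close> on, any string agrees with the known one, and it can only stop where that one stops.\<close>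
  have states: "r \<le> card R \<and> ms ! r = ?st r" if "r < length ms" for r
    using that
  proof (induction r)
    case (Suc r)
    then have r: "r \<le> card R" "ms ! r = ?st r" by simp_all
    have some: "crystal_f a i (?st r) = Some (ms ! Suc r)" using next_state[of r] Suc.prems r by simp
    then have "r \<noteq> card R" using crystal_f_string_state(2)[OF la] by (auto simp: R_def)
    with r have "r < card R" by simp
    with crystal_f_string_state(1)[OF la, of r] some show ?case by (simp add: R_def)
  qed (use j \<open>j = 0\<close> in simp)
  let ?l = "length ms - 1"
  have "ms \<noteq> []" and string_end: "crystal_f a i (ms ! ?l) = None"
    using ms by (auto simp: is_string_def last_conv_nth)
  then have l: "?l \<le> card R" "ms ! ?l = ?st ?l" using states[of ?l] by simp_all
  have "\<not> ?l < card R"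
  proof
    assume "?l < card R"
    then show False
      using crystal_f_string_state(1)[OF la, of ?l] string_end l(2) by (simp add: R_def)
  qed
  with l(1) have "?l = card R" by linarith
  with l(2) have "ms ! ?l = ?st (card R)" by simp
  with mu \<open>j = 0\<close> show "mu = fill la R" by (simp add: full)
qed

text \<open>The weight counts nodes, and each crystal operator adds one node of its residue. A path to the weight
  \<open>\<Lambda> - k \<alpha>\<^sub>i\<close> therefore uses only \<open>i\<close> and stays in the \<open>i\<close>-string of the empty multipartition.\<close>

lemma e_regular_top_weight:
  assumes "e_regular a mu" and "weight a mu = top_weight i k" and "i < 2"
    and la: "string_source a i empty_mpart"
  shows "mu = string_state a i empty_mpart k \<and> k \<le> card (addable_rows a i empty_mpart)"
  using assms(1,2)
proof (induction arbitrary: k)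
  case empty
  then show ?case by (simp add: weight_def nodes_def empty_mpart_def top_weight_def split: if_splits)
next
  case (step nu j mu)
  from step.hyps(3) obtain n where n: "n \<in> addable a j nu" "mu = add_node nu n"
    by (rule crystal_f_SomeE)
  then obtain x where x: "x \<in> addable_rows a j nu" and mu: "mu = fill nu {x}"
    using addable_eq_row_end by metis
  have "card {n \<in> nodes mu. residue a n = r} =
      card {n \<in> nodes nu. residue a n = r} + (if r = j then 1 else 0)" for r
    using card_residue_fill[of nu "{x}" a j r] x e_regular_rows_nodes[OF step.hyps(1)] by (simp add: mu)
  then have "j = i \<and> (\<exists>k'. k = Suc k' \<and> weight a nu = top_weight i k')"
    using step.prems step.hyps(2) assms(3)
    by (cases k) (auto simp: weight_def top_weight_def less_2_cases_iff split: if_splits)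
  then obtain k' where j: "j = i" and k: "k = Suc k'" and "weight a nu = top_weight i k'" by blast
  with step.IH have nu: "nu = string_state a i empty_mpart k'"
    and k': "k' \<le> card (addable_rows a i empty_mpart)" by blast+
  have "k' \<noteq> card (addable_rows a i empty_mpart)"
    using step.hyps(3) crystal_f_string_state(2)[OF la] nu j by auto
  with k' have "k' < card (addable_rows a i empty_mpart)" by simp
  with step.hyps(3) crystal_f_string_state(1)[OF la, of k'] nu j k show ?case by simp
qed

section \<open>Choice sequences\<close>

lemma choice_seqs_conv: "choice_seqs c k =
    {S. length S = c \<and> set S \<subseteq> {0, 1} \<and> length (filter (\<lambda>x. x = 1) S) = k}"
  by (auto simp: choice_seqs_def length_filter_conv_card)

lemma finite_choice_seqs: "finite (choice_seqs c k)"
proof (rule finite_subset)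
  show "choice_seqs c k \<subseteq> {S. set S \<subseteq> {0, 1} \<and> length S = c}"
    by (auto simp: choice_seqs_def)
qed (simp add: finite_lists_length_eq)

lemma choice_seqs_nth:
  assumes "S \<in> choice_seqs c k" and "p < c"
  shows "S ! p = 0 \<or> S ! p = 1"
proof -
  have "S ! p \<in> set S" using assms by (simp add: choice_seqs_def)
  then have "S ! p \<in> {0, 1}" using assms unfolding choice_seqs_def by blast
  then show ?thesis by simp
qed

lemma choice_seqs_0: "choice_seqs 0 k = (if k = 0 then {[]} else {})"
  by (auto simp: choice_seqs_conv)

lemma Cons_in_choice_seqs: "x # S \<in> choice_seqs (Suc c) k \<longleftrightarrow>
    x = 0 \<and> S \<in> choice_seqs c k \<or> x = 1 \<and> k \<noteq> 0 \<and> S \<in> choice_seqs c (k - 1)"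
proof -
  define L where "L = length (filter (\<lambda>y. y = 1) S)"
  have mem: "S \<in> choice_seqs c k' \<longleftrightarrow> length S = c \<and> set S \<subseteq> {0, 1} \<and> L = k'" for k'
    by (simp add: choice_seqs_conv L_def)
  have "x # S \<in> choice_seqs (Suc c) k \<longleftrightarrow>
      (x = 0 \<or> x = 1) \<and> length S = c \<and> set S \<subseteq> {0, 1} \<and> (if x = 1 then Suc L else L) = k"
    unfolding choice_seqs_conv L_def by (simp only: mem_Collect_eq filter.simps length_Cons
        list.set insert_subset insert_iff empty_iff nat.inject if_distrib[of length]) blast
  then show ?thesis unfolding mem by (cases k) auto
qed

lemma choice_seqs_Suc: "choice_seqs (Suc c) k =
    (if k = 0 then {} else (#) 1 ` choice_seqs c (k - 1)) \<union> (#) 0 ` choice_seqs c k"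
  (is "?L = ?R")
proof (rule set_eqI)
  fix S :: "nat list"
  show "S \<in> ?L \<longleftrightarrow> S \<in> ?R"
  proof (cases S)
    case Nil
    then show ?thesis by (auto simp: choice_seqs_def)
  next
    case (Cons x S')
    then show ?thesis by (simp only: Cons_in_choice_seqs) auto
  qed
qed

lemma Inv_Cons: "Inv (x # S) = (if x = 0 then length (filter (\<lambda>y. y = 1) S) else 0) + Inv S"
proof -
  have Inv: "Inv S = (\<Sum>p<length S. if S ! p = 1 then card {q. q < p \<and> S ! q = 0} else 0)" for S
    unfolding Inv_def by (rule sum.mono_neutral_cong_left) auto
  have "card {q. q < Suc p \<and> (x # S) ! q = 0} = (if x = 0 then 1 else 0) + card {q. q < p \<and> S ! q = 0}" for p
  proof -
    have "{q. q < Suc p \<and> (x # S) ! q = 0} =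
        (if x = 0 then {0} else {}) \<union> Suc ` {q. q < p \<and> S ! q = 0}"
      (is "?L = ?R")
    proof (rule set_eqI)
      show "q \<in> ?L \<longleftrightarrow> q \<in> ?R" for q by (cases q) auto
    qed
    then show ?thesis by (auto simp: card_image card_insert_if)
  qed
  then have "Inv (x # S) = (\<Sum>p<length S. if S ! p = 1
      then (if x = 0 then 1 else 0) + card {q. q < p \<and> S ! q = 0} else 0)"
    by (simp add: Inv sum.lessThan_Suc_shift del: sum.lessThan_Suc cong: if_cong)
  also have "\<dots> = (\<Sum>p<length S. if S ! p = 1 then (if x = 0 then 1 else 0) else 0) + Inv S"
    unfolding Inv sum.distrib[symmetric] by (rule sum.cong) auto
  also have "(\<Sum>p<length S. if S ! p = 1 then (if x = 0 then 1 else 0) else 0) =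
      (if x = 0 then length (filter (\<lambda>y. y = 1) S) else 0)"
  proof -
    have "{..<length S} \<inter> {p. S ! p = 1} = {i. i < length S \<and> S ! i = 1}" by auto
    then show ?thesis by (simp add: sum.If_cases length_filter_conv_card)
  qed
  finally show ?thesis .
qed

lemma Inv_Cons_choice:
  assumes "S \<in> choice_seqs c k"
  shows "Inv (1 # S) = Inv S" and "Inv (0 # S) = k + Inv S"
  using assms by (simp_all add: Inv_Cons choice_seqs_conv)

lemma Inv_bound: "S \<in> choice_seqs c k \<Longrightarrow> k \<le> c \<and> Inv S \<le> k * (c - k)"
proof (induction c arbitrary: k S)
  case 0
  then show ?case by (simp add: choice_seqs_0 Inv_def split: if_splits)
next
  case (Suc c)
  from Suc.prems consider S' where "k > 0" "S = 1 # S'" "S' \<in> choice_seqs c (k - 1)"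
    | S' where "S = 0 # S'" "S' \<in> choice_seqs c k"
    by (auto simp: choice_seqs_Suc split: if_splits)
  then show ?case
  proof cases
    case 1
    then obtain k' where k: "k = Suc k'" by (cases k) auto
    with 1 have "k' \<le> c" "Inv S' \<le> k' * (c - k')" using Suc.IH[of S' k'] by simp_all
    moreover have "Inv S = Inv S'" using 1 Inv_Cons_choice by simp
    ultimately show ?thesis by (simp add: k)
  next
    case 2
    then have "k \<le> c" "Inv S' \<le> k * (c - k)" using Suc.IH[of S' k] by simp_all
    moreover have "Inv S = k + Inv S'" using 2 Inv_Cons_choice by simp
    ultimately show ?thesis by (simp add: Suc_diff_le)
  qed
qed

definition ones_first :: "nat \<Rightarrow> nat \<Rightarrow> nat list" where
  "ones_first c k = replicate k 1 @ replicate (c - k) 0"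

lemma ones_first_in_choice_seqs: "k \<le> c \<Longrightarrow> ones_first c k \<in> choice_seqs c k"
  by (auto simp: ones_first_def choice_seqs_conv)

text \<open>Inversions are absent only if no 0 precedes a 1. Hence a single coefficient of the canonical basis
  element is 1, and all others are divisible by \<open>v\<close>.\<close>

lemma Inv_eq_0_iff:
  assumes "S \<in> choice_seqs c k"
  shows "Inv S = 0 \<longleftrightarrow> S = ones_first c k"
  using assms
proof (induction c arbitrary: k S)
  case 0
  then show ?case by (simp add: choice_seqs_0 Inv_def ones_first_def split: if_splits)
next
  case (Suc c)
  from Suc.prems consider S' where "k > 0" "S = 1 # S'" "S' \<in> choice_seqs c (k - 1)"
    | S' where "S = 0 # S'" "S' \<in> choice_seqs c k"
    by (auto simp: choice_seqs_Suc split: if_splits)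
  then show ?case
  proof cases
    case 1
    then obtain k' where k: "k = Suc k'" by (cases k) auto
    with 1 show ?thesis using Suc.IH[of S' k'] Inv_Cons_choice by (simp add: ones_first_def)
  next
    case 2
    then have "k \<le> c" using Inv_bound by blast
    show ?thesis
    proof (cases "k = 0")
      case True
      with 2 show ?thesis using Suc.IH[of S' k] Inv_Cons_choice[of S'] by (simp add: ones_first_def)
    next
      case False
      with 2 show ?thesis using Inv_Cons_choice[of S'] by (cases k) (simp_all add: ones_first_def)
    qed
  qed
qed

lemma s_num_eq_0: "b > 0 \<Longrightarrow> k < 0 \<or> l < 0 \<Longrightarrow> s_num b k l = 0"
  by (induction b k l rule: s_num.induct) (auto simp: mult_less_0_iff dest: order_trans)

text \<open>The recursion for \<open>s_num\<close> splits choice sequences by their first entry: a leading 1 contributes no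
  inversion, a leading 0 one with each of the \<open>k\<close> entries 1.\<close>

lemma card_choice_seqs_Inv:
  assumes "c > 0"
  shows "int (card {S \<in> choice_seqs c k. Inv S = l}) = s_num c (int k) (int l)"
  using assms
proof (induction c arbitrary: k l)
  case (Suc c)
  let ?N = "\<lambda>c k l. card {S \<in> choice_seqs c k. Inv S = l}"
  have rec: "?N (Suc c) k l = (if k = 0 then 0 else ?N c (k - 1) l) + (if k \<le> l then ?N c k (l - k) else 0)"
  proof -
    have "{S \<in> choice_seqs (Suc c) k. Inv S = l} =
        (if k = 0 then {} else (#) 1 ` {S \<in> choice_seqs c (k - 1). Inv S = l}) \<union>
        (if k \<le> l then (#) 0 ` {S \<in> choice_seqs c k. Inv S = l - k} else {})"
      (is "?L = ?R")
    proof (rule set_eqI)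
      fix S :: "nat list"
      have img: "x # T \<in> (#) y ` A \<longleftrightarrow> x = y \<and> T \<in> A" for x y :: nat and T A by auto
      show "S \<in> ?L \<longleftrightarrow> S \<in> ?R"
      proof (cases S)
        case Nil
        then show ?thesis by (auto simp: choice_seqs_def)
      next
        case (Cons x T)
        show ?thesis
        proof (cases "x = 0")
          case True
          then show ?thesis
            by (auto simp: Cons Cons_in_choice_seqs img Inv_Cons_choice)
        next
          case False
          then show ?thesis
            by (auto simp: Cons Cons_in_choice_seqs img Inv_Cons_choice simp del: One_nat_def)
        qed
      qed
    qed
    moreover have "finite {S \<in> choice_seqs c' k'. Inv S = l'}" for c' k' l'
      using finite_choice_seqs by simp
    moreover have "(#) (1::nat) ` A \<inter> (#) 0 ` B = {}" for A B by auto
    ultimately show ?thesis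
      by (auto simp: card_image intro!: trans[OF card_Un_disjoint])
  qed
  show ?case
  proof (cases c)
    case 0
    have "{S \<in> choice_seqs 0 k. Inv S = l} = (if k = 0 \<and> l = 0 then {[]} else {})" for k l
      by (auto simp: choice_seqs_0 Inv_def)
    then show ?thesis unfolding rec by (auto simp: 0)
  next
    case (Suc b)
    then have c: "c > 0" by simp
    then have IH: "int (?N c k l) = s_num c (int k) (int l)" for k l by (rule Suc.IH)
    show ?thesis
    proof (cases "int l \<le> int k * (int (Suc c) - int k)")
      case True
      then have "s_num (Suc c) (int k) (int l) =
          s_num c (int k - 1) (int l) + s_num c (int k) (int l - int k)"
        by (simp add: Suc)
      moreover have "s_num c (int k - 1) (int l) = int (if k = 0 then 0 else ?N c (k - 1) l)"
        using s_num_eq_0[OF c, of "- 1" "int l"] by (cases k) (simp_all add: IH)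
      moreover have "s_num c (int k) (int l - int k) = int (if k \<le> l then ?N c k (l - k) else 0)"
        using s_num_eq_0[OF c, of "int k" "int l - int k"] by (simp add: IH of_nat_diff)
      ultimately show ?thesis by (simp add: rec)
    next
      case False
      have "\<not> (S \<in> choice_seqs (Suc c) k \<and> Inv S = l)" for S
      proof
        assume "S \<in> choice_seqs (Suc c) k \<and> Inv S = l"
        then have "k \<le> Suc c" "l \<le> k * (Suc c - k)" using Inv_bound by blast+
        then have "int l \<le> int k * (int (Suc c) - int k)"
          by (metis of_nat_diff of_nat_mult of_nat_le_iff)
        with False show False by simp
      qed
      then have "{S \<in> choice_seqs (Suc c) k. Inv S = l} = {}" by blast
      then have "int (?N (Suc c) k l) = 0" by (simp only: card.empty of_nat_0)
      also have "0 = s_num (Suc c) (int k) (int l)" using False by (simp add: Suc)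
      finally show ?thesis .
    qed
  qed
qed simp

section \<open>The multipartitions tau\<close>

definition tau_height :: "nat \<Rightarrow> nat \<Rightarrow> nat \<Rightarrow> nat list \<Rightarrow> nat \<Rightarrow> int" where
  "tau_height a i n S c = (if i * a \<le> c \<and> c < i * a + a
     then (if S ! (c - i * a) = 1 then int n + 1 else int n - 1) else int n)"

lemma tau_eq: "tau a i n S = (\<lambda>c t. if c < 2 * a then nat (tau_height a i n S c - int t) else 0)"
  by (auto simp: tau_def staircase_def tau_height_def fun_eq_iff)

lemma residue_eq_iff:
  assumes "j < 2"
  shows "residue a (c, t, u) = j \<longleftrightarrow> even ((if c < a then 0 else 1) + int u - int t - int j)"
proof -
  have "nat (x mod 2) = j \<longleftrightarrow> even (x - int j)" for x :: int
    using assms by (cases "even x") (auto simp: less_2_cases_iff odd_iff_mod_2_eq_one)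
  then show ?thesis by (simp only: residue.simps)
qed

lemma tau_height_parity:
  assumes "i < 2" and "c < 2 * a"
  shows "even ((if c < a then 0 else 1) + tau_height a i n S c - int ((i + n + 1) mod 2))"
proof -
  have "even (x - int (m mod 2)) \<longleftrightarrow> even (x - int m)" for x m
    by (simp add: zmod_int)
  then show ?thesis using assms by (auto simp: tau_height_def less_2_cases_iff)
qed

text \<open>The end of row \<open>t\<close> of a staircase \<open>T\<^sub>h\<close> lies in column \<open>h - t\<close>, so that all addable nodes of \<open>T\<^sub>h\<close> have
  one residue and all removable nodes the other. The heights in \<open>tau\<close> are
  chosen such that these residues agree for all components. For \<open>n = 0\<close> the height \<open>- 1\<close> also stands for an empty
  component; its corner is addable with the other residue, in accordance with the absence of rows
  \<open>t \<le> - 1\<close>.\<close>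

lemma addable_rows_tau:
  assumes "i < 2"
  shows "addable_rows a ((i + n + 1) mod 2) (tau a i n S) =
    {(c, t). c < 2 * a \<and> int t \<le> tau_height a i n S c}"
proof (intro set_eqI iffI)
  let ?h = "tau_height a i n S" and ?j = "(i + n + 1) mod 2"
  have j: "?j < 2" by simp
  fix x assume x: "x \<in> addable_rows a ?j (tau a i n S)"
  obtain c t where xe: "x = (c, t)" by (cases x)
  have c: "c < 2 * a" and res: "residue a (c, t, tau a i n S c t) = ?j"
    and less: "t = 0 \<or> tau a i n S c t < tau a i n S c (t - 1)"
    using x by (auto simp: xe addable_rows_def addable_def row_end_def simp del: residue.simps)
  have "int t \<le> ?h c"
  proof (rule ccontr)
    assume neg: "\<not> int t \<le> ?h c"
    then have "tau a i n S c t = 0" by (simp add: tau_eq)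
    moreover have "t = 0"
    proof (rule ccontr)
      assume "t \<noteq> 0"
      with less neg c show False by (simp add: tau_eq)
    qed
    ultimately have "residue a (c, 0, 0) = ?j" using res by (simp only:)
    then have even: "even ((if c < a then 0 else 1) + int 0 - int 0 - int ?j)"
      by (simp only: residue_eq_iff[OF j])
    have "?h c = -1"
      using neg \<open>t = 0\<close> by (auto simp: tau_height_def split: if_splits)
    with tau_height_parity[OF assms c, of n S]
    have even': "even ((if c < a then 0 else 1) + (- 1) - int ?j)" by (simp only:)
    have parity: "even (y + (- 1) - z) \<Longrightarrow> odd (y + int 0 - int 0 - z)" for y z :: int
      unfolding of_nat_0 by presburger
    show False by (rule notE[OF parity[OF even'] even])
  qed
  with c show "x \<in> {(c, t). c < 2 * a \<and> int t \<le> ?h c}" by (simp add: xe)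
next
  let ?h = "tau_height a i n S" and ?j = "(i + n + 1) mod 2"
  have j: "?j < 2" by simp
  fix x assume "x \<in> {(c, t). c < 2 * a \<and> int t \<le> ?h c}"
  then obtain c t where x: "x = (c, t)" and c: "c < 2 * a" and t: "int t \<le> ?h c" by auto
  have u: "int (tau a i n S c t) = ?h c - int t"
    using c t by (simp add: tau_eq)
  have parity: "even (y + h - z) \<Longrightarrow> even (y + (h - m) - m - z)" for y h m z :: int by simp
  have "residue a (c, t, tau a i n S c t) = ?j"
    unfolding residue_eq_iff[OF j] u by (rule parity[OF tau_height_parity[OF assms c]])
  moreover have "t = 0 \<or> tau a i n S c t < tau a i n S c (t - 1)"
    using c t by (auto simp: tau_eq)
  ultimately show "x \<in> addable_rows a ?j (tau a i n S)"
    using c by (simp add: x addable_rows_def addable_def row_end_def del: residue.simps)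
qed

lemma tau_height_rows_conv: "{(c, t). c < 2 * a \<and> int t \<le> tau_height a i n S c} =
    Sigma {..<2 * a} (\<lambda>c. {..<nat (tau_height a i n S c + 1)})"
  by auto

lemma string_source_tau:
  assumes "i < 2"
  shows "string_source a ((i + n + 1) mod 2) (tau a i n S)"
  unfolding string_source_def
proof (intro conjI)
  let ?h = "tau_height a i n S" and ?j = "(i + n + 1) mod 2"
  have j: "?j < 2" by simp
  show "rows_decreasing (tau a i n S)" by (auto simp: rows_decreasing_def tau_eq)
  show "finite (addable_rows a ?j (tau a i n S))"
    unfolding addable_rows_tau[OF assms] tau_height_rows_conv by simp
  have False if n: "(c, t, u) \<in> removable a ?j (tau a i n S)" for c t u
  proof -
    from n have c: "c < 2 * a" and u: "Suc u = tau a i n S c t" and res: "residue a (c, t, u) = ?j"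
      by (auto simp: removable_def simp del: residue.simps)
    have "int u = ?h c - int t - 1" using u c by (simp add: tau_eq)
    with res have even: "even ((if c < a then 0 else 1) + (?h c - int t - 1) - int t - int ?j)"
      by (simp only: residue_eq_iff[OF j])
    have parity: "even (y + h - z) \<Longrightarrow> odd (y + (h - m - 1) - m - z)" for y h m z :: int
      by presburger
    show False by (rule notE[OF parity[OF tau_height_parity[OF assms c]] even])
  qed
  then show "removable a ?j (tau a i n S) = {}" by auto
qed

text \<open>Adding all nodes of the relevant residue raises the height of each staircase by one.\<close>

lemma fill_tau:
  assumes "i < 2"
  shows "fill (tau a i n S) (addable_rows a ((i + n + 1) mod 2) (tau a i n S)) = tau a i (Suc n) S"
  unfolding addable_rows_tau[OF assms]
  by (auto simp: fill_def tau_eq tau_height_def fun_eq_iff)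

lemma card_addable_rows_tau:
  assumes "i < 2" and "S \<in> choice_seqs a k"
  shows "card (addable_rows a ((i + n + 1) mod 2) (tau a i n S)) = 2 * a * n + a + 2 * k"
proof -
  let ?g = "\<lambda>c. if i * a \<le> c \<and> c < i * a + a then (if S ! (c - i * a) = 1 then 2 else 0) else 1 :: nat"
  have "card (addable_rows a ((i + n + 1) mod 2) (tau a i n S)) =
      (\<Sum>c<2 * a. nat (tau_height a i n S c + 1))"
    unfolding addable_rows_tau[OF assms(1)] tau_height_rows_conv by simp
  also have "\<dots> = (\<Sum>c<2 * a. n + ?g c)"
    by (rule sum.cong) (auto simp: tau_height_def)
  also have "\<dots> = 2 * a * n + (\<Sum>c<2 * a. ?g c)"
    by (simp add: sum.distrib)
  also have "(\<Sum>c<2 * a. ?g c) = a + 2 * k"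
  proof -
    let ?I = "{i * a..<i * a + a}"
    have I: "?I \<subseteq> {..<2 * a}" using assms(1) by (auto simp: less_2_cases_iff)
    have "(\<Sum>c<2 * a. ?g c) = (\<Sum>c\<in>{..<2 * a} - ?I. ?g c) + (\<Sum>c\<in>?I. ?g c)"
      by (rule sum.subset_diff[OF I]) simp
    also have "(\<Sum>c\<in>{..<2 * a} - ?I. ?g c) = (\<Sum>c\<in>{..<2 * a} - ?I. 1)"
      by (rule sum.cong) auto
    also have "\<dots> = a" using I by (simp add: card_Diff_subset)
    also have "(\<Sum>c\<in>?I. ?g c) = (\<Sum>p<a. if S ! p = 1 then 2 else 0)"
      by (rule sum.reindex_bij_witness[where i = "\<lambda>p. i * a + p" and j = "\<lambda>c. c - i * a"]) auto
    also have "\<dots> = 2 * k"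
    proof -
      have "{..<a} \<inter> {p. S ! p = 1} = {p. p < a \<and> S ! p = 1}" by auto
      then show ?thesis using assms(2) by (simp add: sum.If_cases choice_seqs_def)
    qed
    finally show ?thesis .
  qed
  finally show ?thesis by simp
qed

lemma tau_inj:
  assumes "i < 2"
  shows "inj_on (tau a i n) (choice_seqs a k)"
proof (rule inj_onI, rule nth_equalityI)
  fix S S' assume S: "S \<in> choice_seqs a k" and S': "S' \<in> choice_seqs a k"
    and eq: "tau a i n S = tau a i n S'"
  show "length S = length S'" using S S' by (simp add: choice_seqs_def)
  fix p assume "p < length S"
  then have p: "p < a" using S by (simp add: choice_seqs_def)
  then have "i * a + p < 2 * a" using assms by (auto simp: less_2_cases_iff)
  with fun_cong[OF fun_cong[OF eq], of "i * a + p" 0] p have "S ! p = 1 \<longleftrightarrow> S' ! p = 1"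
    by (auto simp: tau_eq tau_height_def split: if_splits)
  then show "S ! p = S' ! p"
    using choice_seqs_nth[OF S p] choice_seqs_nth[OF S' p] by auto
qed

section \<open>The top rows\<close>

definition corners :: "nat \<Rightarrow> nat \<Rightarrow> nat set \<Rightarrow> (nat \<times> nat) set" where
  "corners a i P = (\<lambda>p. (i * a + p, 0)) ` P"

lemma addable_rows_empty:
  assumes "i < 2"
  shows "addable_rows a i empty_mpart = corners a i {..<a}"
proof (rule set_eqI)
  fix x :: "nat \<times> nat"
  obtain c t where x: "x = (c, t)" by (cases x)
  have "x \<in> addable_rows a i empty_mpart \<longleftrightarrow> c < 2 * a \<and> t = 0 \<and> (c < a \<longleftrightarrow> i = 0)"
    using assms by (auto simp: x addable_rows_def addable_def row_end_def empty_mpart_def less_2_cases_iff)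
  also have "\<dots> \<longleftrightarrow> t = 0 \<and> i * a \<le> c \<and> c < i * a + a"
    using assms by (auto simp: less_2_cases_iff)
  also have "\<dots> \<longleftrightarrow> x \<in> corners a i {..<a}"
    by (auto simp: x corners_def image_iff intro: bexI[of _ "c - i * a"])
  finally show "x \<in> addable_rows a i empty_mpart \<longleftrightarrow> x \<in> corners a i {..<a}" .
qed

lemma inj_corner: "inj_on (\<lambda>p. (i * a + p, 0 :: nat)) A" for i a :: nat
  by (auto simp: inj_on_def)

lemma string_source_empty: "i < 2 \<Longrightarrow> string_source a i empty_mpart"
  by (simp add: string_source_def addable_rows_empty corners_def)
    (simp add: rows_decreasing_def removable_def empty_mpart_def)

lemma fill_empty_corners: "i < 2 \<Longrightarrow> fill empty_mpart (corners a i {p. p < a \<and> S ! p = 1}) = tau a i 0 S"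
  by (auto simp: fill_def corners_def tau_eq tau_height_def fun_eq_iff empty_mpart_def image_iff
      less_2_cases_iff)

text \<open>The addable \<open>i\<close>-nodes of the empty multipartition are the corners of \<open>a\<close> components, and a choice sequence
  selects some of them.\<close>

lemma choice_seqs_subsets:
  assumes "i < 2"
  shows "bij_betw (\<lambda>S. corners a i {p. p < a \<and> S ! p = 1}) (choice_seqs a k)
    {B. B \<subseteq> corners a i {..<a} \<and> card B = k}"
proof (rule bij_betw_byWitness[where f' = "\<lambda>B. map (\<lambda>p. if (i * a + p, 0) \<in> B then 1 else 0) [0..<a]"])
  show "\<forall>S\<in>choice_seqs a k. map (\<lambda>p. if (i * a + p, 0) \<in> corners a i {p. p < a \<and> S ! p = 1}
      then 1 else 0) [0..<a] = S"
  proof (intro ballI nth_equalityI)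
    fix S p assume S: "S \<in> choice_seqs a k"
      and "p < length (map (\<lambda>p. if (i * a + p, 0) \<in> corners a i {p. p < a \<and> S ! p = 1}
        then 1 else 0 :: nat) [0..<a])"
    then show "map (\<lambda>p. if (i * a + p, 0) \<in> corners a i {p. p < a \<and> S ! p = 1}
      then 1 else 0) [0..<a] ! p = S ! p"
      using choice_seqs_nth[OF S, of p] by (auto simp: corners_def)
  qed (simp add: choice_seqs_def)
  have eq: "corners a i {p. p < a \<and>
      map (\<lambda>p. if (i * a + p, 0) \<in> B then 1 else 0 :: nat) [0..<a] ! p = 1} = B"
    if "B \<subseteq> corners a i {..<a}" for B
    using that by (auto simp: corners_def split: if_splits)
  then show "\<forall>B\<in>{B. B \<subseteq> corners a i {..<a} \<and> card B = k}. corners a i {p. p < a \<and>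
      map (\<lambda>p. if (i * a + p, 0) \<in> B then 1 else 0 :: nat) [0..<a] ! p = 1} = B"
    by blast
  show "(\<lambda>S. corners a i {p. p < a \<and> S ! p = 1}) ` choice_seqs a k \<subseteq>
      {B. B \<subseteq> corners a i {..<a} \<and> card B = k}"
    by (auto simp: corners_def choice_seqs_def card_image[OF inj_corner])
  show "(\<lambda>B. map (\<lambda>p. if (i * a + p, 0) \<in> B then 1 else 0) [0..<a]) `
      {B. B \<subseteq> corners a i {..<a} \<and> card B = k} \<subseteq> choice_seqs a k"
  proof clarify
    fix B assume B: "B \<subseteq> corners a i {..<a}" "k = card B"
    let ?S = "map (\<lambda>p. if (i * a + p, 0) \<in> B then 1 else 0 :: nat) [0..<a]"
    have "card (corners a i {p. p < a \<and> ?S ! p = 1}) = card {p. p < a \<and> ?S ! p = 1}"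
      unfolding corners_def by (rule card_image[OF inj_corner])
    then have "card {p. p < a \<and> ?S ! p = 1} = card B" by (simp only: eq[OF B(1)])
    then show "?S \<in> choice_seqs a (card B)" by (auto simp: choice_seqs_def)
  qed
qed

lemma invs_corners:
  assumes "S \<in> choice_seqs a k"
  shows "invs (corners a i {..<a}) (corners a i {p. p < a \<and> S ! p = 1}) = Inv S"
proof -
  have len: "length S = a" using assms by (simp add: choice_seqs_def)
  let ?B = "corners a i {p. p < a \<and> S ! p = 1}"
  have "corners a i {..<a} - ?B = corners a i ({..<a} - {p. p < a \<and> S ! p = 1})"
    unfolding corners_def by (rule inj_on_image_set_diff[OF inj_corner, symmetric]) auto
  also have "{..<a} - {p. p < a \<and> S ! p = 1} = {q. q < a \<and> S ! q = 0}"
    using choice_seqs_nth[OF assms] by auto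
  finally have compl: "corners a i {..<a} - ?B = corners a i {q. q < a \<and> S ! q = 0}" .
  have "card {x \<in> corners a i {..<a} - ?B. x < (i * a + p, 0)} = card {q. q < p \<and> S ! q = 0}"
    if "p < a" for p
  proof -
    have "{x \<in> corners a i {..<a} - ?B. x < (i * a + p, 0)} = corners a i {q. q < p \<and> S ! q = 0}"
      unfolding compl using that by (auto simp: corners_def)
    then show ?thesis by (simp add: corners_def card_image[OF inj_corner])
  qed
  then have "invs (corners a i {..<a}) ?B = (\<Sum>p | p < a \<and> S ! p = 1. card {q. q < p \<and> S ! q = 0})"
    unfolding invs_def by (subst (2) corners_def) (simp add: sum.reindex[OF inj_corner])
  then show ?thesis by (simp add: Inv_def len)
qed

lemma string_state_empty:
  assumes "i < 2" and "k \<le> a"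
  shows "string_state a i empty_mpart k = tau a i 0 (ones_first a k)"
proof -
  have "sorted_list_of_set (corners a i {..<a}) = map (\<lambda>p. (i * a + p, 0)) [0..<a]"
    by (rule strict_sorted_equal) (auto simp: corners_def sorted_wrt_map)
  then have "set (take k (sorted_list_of_set (addable_rows a i empty_mpart))) = corners a i {..<k}"
    using assms by (auto simp: addable_rows_empty take_map corners_def)
  moreover have "ones_first a k ! p = (if p < k then 1 else 0)" if "p < a" for p
    using that by (simp add: ones_first_def nth_append diff_less_mono)
  then have "{..<k} = {p. p < a \<and> ones_first a k ! p = 1}"
    using assms by (auto split: if_splits)
  ultimately show ?thesis
    using fill_empty_corners[OF assms(1), of a "ones_first a k"] by (simp add: string_state_def)
qed

section \<open>The orbit of the top rows\<close>

lemma e_regular_tau_0: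
  assumes "i < 2" and "k \<le> a"
  shows "e_regular a (tau a i 0 (ones_first a k))"
proof -
  have "card (addable_rows a i empty_mpart) = a"
    using assms by (simp add: addable_rows_empty corners_def card_image[OF inj_corner])
  then show ?thesis
    using e_regular_string_state[OF e_regular.empty[of a] string_source_empty[OF assms(1)] assms(1), of k]
      string_state_empty[OF assms] assms(2) by simp
qed

lemma e_regular_tau:
  assumes "i < 2" and "k \<le> a"
  shows "e_regular a (tau a i n (ones_first a k))"
proof (induction n)
  case (Suc n)
  let ?j = "(i + n + 1) mod 2" and ?la = "tau a i n (ones_first a k)"
  have la: "string_source a ?j ?la" by (rule string_source_tau[OF assms(1)])
  have "e_regular a (string_state a ?j ?la (card (addable_rows a ?j ?la)))"
    by (rule e_regular_string_state[OF Suc la]) simp_all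
  moreover have "string_state a ?j ?la (card (addable_rows a ?j ?la)) = tau a i (Suc n) (ones_first a k)"
    using la string_state_all[of a ?j ?la] unfolding string_source_def fill_tau[OF assms(1)] by blast
  ultimately show ?case by simp
qed (rule e_regular_tau_0[OF assms])

text \<open>Each \<open>tau\<close> is the first element of its string for the residue \<open>i + n + 1\<close>, and the reflection
  carries it to the last one.\<close>

lemma crystal_s_tau:
  assumes "i < 2" and "k \<le> a"
  shows "crystal_s a ((i + n + 1) mod 2) (tau a i n (ones_first a k)) =
    tau a i (Suc n) (ones_first a k)"
  using crystal_s_fill[OF e_regular_tau[OF assms] _ string_source_tau[OF assms(1)]]
    fill_tau[OF assms(1)] by simp

lemma weight_tau_0:
  assumes "i < 2" and "k \<le> a"
  shows "weight a (tau a i 0 (ones_first a k)) = top_weight i k"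
proof -
  let ?S = "ones_first a k"
  let ?B = "corners a i {p. p < a \<and> ?S ! p = 1}"
  have none: "nodes empty_mpart = {}" by (auto simp: nodes_def empty_mpart_def)
  have "?B \<subseteq> addable_rows a i empty_mpart"
    unfolding addable_rows_empty[OF assms(1)] by (auto simp: corners_def)
  moreover have "finite ?B" by (simp add: corners_def)
  moreover have "card ?B = k"
    using ones_first_in_choice_seqs[OF assms(2)]
    by (simp add: corners_def card_image[OF inj_corner] choice_seqs_def)
  ultimately have "card {n \<in> nodes (tau a i 0 ?S). residue a n = j} = (if j = i then k else 0)" for j
    using card_residue_fill[of empty_mpart ?B a i j] fill_empty_corners[OF assms(1), of a ?S]
    by (simp add: none)
  then show ?thesis using assms(1) by (auto simp: weight_def top_weight_def less_2_cases_iff)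
qed

lemma defect_step:
  fixes x y A K m :: int
  assumes "x - y = A * m + K" and "A * (x + y) - (x - y)\<^sup>2 = K * (A - K)"
  shows "y + (2 * A * m + A + 2 * K) - x = A * (m + 1) + K \<and>
    A * (y + (2 * A * m + A + 2 * K) + x) - (y + (2 * A * m + A + 2 * K) - x)\<^sup>2 = K * (A - K)"
proof -
  have x: "x = y + (A * m + K)" using assms(1) by simp
  show ?thesis using assms(2) unfolding x by (simp add: algebra_simps power2_eq_square)
qed

text \<open>Let \<open>x\<close> and \<open>y\<close> be the numbers of nodes of residue \<open>i + n\<close> and \<open>i + n + 1\<close>. The defect is
  \<open>a (x + y) - (x - y)\<^sup>2\<close>. A step adds \<open>2 a n + a + 2 k\<close> nodes of the second residue and turns the
  difference \<open>a n + k\<close> into \<open>a (n + 1) + k\<close>, which leaves the defect unchanged.\<close>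

lemma node_counts_tau:
  assumes "i < 2" and "k \<le> a"
  defines "N \<equiv> \<lambda>n j. int (card {m \<in> nodes (tau a i n (ones_first a k)). residue a m = j mod 2})"
  shows "N n (i + n) - N n (i + n + 1) = int (a * n + k) \<and>
    int a * (N n (i + n) + N n (i + n + 1)) - (N n (i + n) - N n (i + n + 1))\<^sup>2 =
      int k * (int a - int k)"
proof (induction n)
  case 0
  have "N 0 i = int k" "N 0 (i + 1) = 0"
    using weight_tau_0[OF assms(1,2)] assms(1)
    by (auto simp: N_def weight_def top_weight_def less_2_cases_iff)
  then show ?case by (simp add: algebra_simps power2_eq_square)
next
  case (Suc n)
  let ?j = "(i + n + 1) mod 2" and ?la = "tau a i n (ones_first a k)"
  have card: "card (addable_rows a ?j ?la) = 2 * a * n + a + 2 * k"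
    by (rule card_addable_rows_tau[OF assms(1) ones_first_in_choice_seqs[OF assms(2)]])
  have "finite (addable_rows a ?j ?la)"
    using string_source_tau[OF assms(1), of a n "ones_first a k"] unfolding string_source_def by blast
  then have step: "N (Suc n) j = N n j + (if j mod 2 = ?j then int (2 * a * n + a + 2 * k) else 0)" for j
    using card_residue_fill[of ?la "addable_rows a ?j ?la" a ?j "j mod 2"]
      e_regular_rows_nodes[OF e_regular_tau[OF assms(1,2), of n]]
    unfolding N_def fill_tau[OF assms(1)] card by simp
  have counts: "N (Suc n) (i + Suc n) = N n (i + n + 1) + int (2 * a * n + a + 2 * k)"
    by (simp add: step)
  have counts': "N (Suc n) (i + Suc n + 1) = N n (i + n)"
  proof -
    have "(i + Suc n + 1) mod 2 = (i + n) mod 2" by presburger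
    moreover have "(i + n) mod 2 \<noteq> ?j" by presburger
    ultimately have "N (Suc n) (i + Suc n + 1) = N n (i + Suc n + 1)" by (simp add: step)
    also have "\<dots> = N n (i + n)"
      unfolding N_def \<open>(i + Suc n + 1) mod 2 = (i + n) mod 2\<close> ..
    finally show ?thesis .
  qed
  have cast: "int (2 * a * n + a + 2 * k) = 2 * int a * int n + int a + 2 * int k"
      "int (a * Suc n + k) = int a * (int n + 1) + int k" "int (a * n + k) = int a * int n + int k"
    by (simp_all add: algebra_simps)
  from defect_step[OF Suc[THEN conjunct1, unfolded cast] Suc[THEN conjunct2]]
  show ?case unfolding counts counts' cast .
qed

lemma defect_tau:
  assumes "i < 2" and "k \<le> a"
  shows "defect a (weight a (tau a i n (ones_first a k))) = int (k * (a - k))"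
proof -
  define N where "N j = int (card {m \<in> nodes (tau a i n (ones_first a k)). residue a m = j})" for j
  have "defect a (weight a (tau a i n (ones_first a k))) = int a * (N 0 + N 1) - (N 0 - N 1)\<^sup>2"
    by (simp add: defect_def weight_def N_def Let_def power2_eq_square algebra_simps)
  moreover have "(i + n) mod 2 = 0 \<and> (i + n + 1) mod 2 = 1 \<or> (i + n) mod 2 = 1 \<and> (i + n + 1) mod 2 = 0"
    by presburger
  then have "int a * (N 0 + N 1) - (N 0 - N 1)\<^sup>2 = int k * (int a - int k) \<or>
      int a * (N 1 + N 0) - (N 1 - N 0)\<^sup>2 = int k * (int a - int k)"
    using node_counts_tau[OF assms, of n] unfolding N_def by (elim disjE conjE) (simp_all only: simp_thms)
  ultimately have "defect a (weight a (tau a i n (ones_first a k))) = int k * (int a - int k)"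
    by (metis add.commute power2_commute)
  then show ?thesis using assms(2) by (simp add: of_nat_diff)
qed

section \<open>The canonical basis elements\<close>

definition G_tau :: "nat \<Rightarrow> nat \<Rightarrow> nat \<Rightarrow> nat \<Rightarrow> fock" where
  "G_tau a i k n = (\<Sum>S\<in>choice_seqs a k. Poly_Mapping.single (tau a i n S) (v ^ Inv S))"

lemma divided_power_vac:
  assumes "i < 2"
  shows "divided_power a i k vac = G_tau a i k 0"
proof -
  let ?C = "\<lambda>S. corners a i {p. p < a \<and> S ! p = 1}"
  have "divided_power a i k vac = (\<Sum>B | B \<subseteq> corners a i {..<a} \<and> card B = k.
      Poly_Mapping.single (fill empty_mpart B) (v ^ invs (corners a i {..<a}) B))"
    using divided_power_fill[OF string_source_empty[OF assms]]
    by (simp add: vac_def addable_rows_empty[OF assms])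
  also have "\<dots> = (\<Sum>S\<in>choice_seqs a k.
      Poly_Mapping.single (fill empty_mpart (?C S)) (v ^ invs (corners a i {..<a}) (?C S)))"
    by (rule sum.reindex_bij_betw[OF choice_seqs_subsets[OF assms], symmetric])
  also have "\<dots> = G_tau a i k 0"
    unfolding G_tau_def by (rule sum.cong) (simp_all only: fill_empty_corners[OF assms] invs_corners)
  finally show ?thesis .
qed

text \<open>All terms of \<open>G_tau\<close> have equally many addable nodes of the relevant residue and no removable ones, so
  that a single divided power maps each of them to one multipartition with coefficient 1.\<close>

lemma divided_power_G_tau:
  assumes "i < 2"
  shows "divided_power a ((i + n + 1) mod 2) (2 * a * n + a + 2 * k) (G_tau a i k n) =
    G_tau a i k (Suc n)"
proof -
  let ?D = "divided_power a ((i + n + 1) mod 2) (2 * a * n + a + 2 * k)"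
  have "?D (Poly_Mapping.single (tau a i n S) (v ^ Inv S)) =
      Poly_Mapping.single (tau a i (Suc n) S) (v ^ Inv S)" if "S \<in> choice_seqs a k" for S
  proof -
    have "?D (Poly_Mapping.single (tau a i n S) 1) = Poly_Mapping.single (tau a i (Suc n) S) 1"
      using divided_power_fill_all[OF string_source_tau[OF assms], of a n S]
      unfolding card_addable_rows_tau[OF assms that] fill_tau[OF assms] .
    then show ?thesis
      using divided_power_scale[of a _ _ "v ^ Inv S" "Poly_Mapping.single (tau a i n S) 1"] by simp
  qed
  then show ?thesis by (simp add: G_tau_def divided_power_sum)
qed

lemma lookup_G_tau:
  assumes "i < 2" and "S \<in> choice_seqs a k"
  shows "Poly_Mapping.lookup (G_tau a i k n) (tau a i n S) = v ^ Inv S"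
proof -
  have "tau a i n S' = tau a i n S \<longleftrightarrow> S' = S" if "S' \<in> choice_seqs a k" for S'
    using inj_on_eq_iff[OF tau_inj[OF assms(1)] that assms(2)] .
  then have "Poly_Mapping.lookup (G_tau a i k n) (tau a i n S) =
      (\<Sum>S'\<in>choice_seqs a k. if S' = S then v ^ Inv S' else 0)"
    unfolding G_tau_def lookup_sum lookup_single by (intro sum.cong) (simp_all add: when_def)
  then show ?thesis using assms(2) finite_choice_seqs by simp
qed

lemma lookup_G_tau_other:
  assumes "la \<notin> tau a i n ` choice_seqs a k"
  shows "Poly_Mapping.lookup (G_tau a i k n) la = 0"
  unfolding G_tau_def lookup_sum lookup_single
  by (rule sum.neutral) (use assms in auto)

lemma keys_G_tau:
  assumes "i < 2"
  shows "Poly_Mapping.keys (G_tau a i k n) = tau a i n ` choice_seqs a k"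
proof (rule set_eqI)
  fix la
  show "la \<in> Poly_Mapping.keys (G_tau a i k n) \<longleftrightarrow> la \<in> tau a i n ` choice_seqs a k"
    using lookup_G_tau[OF assms, of _ a k n] lookup_G_tau_other[of la a i n k]
    by (auto simp: in_keys_iff)
qed

lemma bar_graph_divided_power:
  assumes "bar_graph a x x" and "i < 2"
  shows "bar_graph a (divided_power a i k x) (divided_power a i k x)"
proof -
  have "bar_graph a ((fock_f a i ^^ k) x) ((fock_f a i ^^ k) x)"
    by (induction k) (simp_all add: assms bar_graph.f)
  from bar_graph.scale[OF this, of "1 / qfact k"] show ?thesis
    by (simp only: bar_coeff_inverse_qfact divided_power_def)
qed

lemma G_tau_monomial:
  assumes "i < 2"
  shows "bar_graph a (G_tau a i k n) (G_tau a i k n) \<and>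
    (\<exists>iks. set (map fst iks) \<subseteq> {0, 1} \<and>
      G_tau a i k n = foldr (\<lambda>(i, k). divided_power a i k) iks vac)"
proof (induction n)
  case 0
  have "bar_graph a (G_tau a i k 0) (G_tau a i k 0)"
    using bar_graph_divided_power[OF bar_graph.vac assms] divided_power_vac[OF assms] by metis
  moreover have "G_tau a i k 0 = foldr (\<lambda>(i, k). divided_power a i k) [(i, k)] vac"
    by (simp add: divided_power_vac[OF assms])
  ultimately show ?case using assms by (intro conjI exI[of _ "[(i, k)]"]) auto
next
  case (Suc n)
  let ?j = "(i + n + 1) mod 2" and ?m = "2 * a * n + a + 2 * k"
  from Suc obtain iks where bar: "bar_graph a (G_tau a i k n) (G_tau a i k n)"
    and iks: "set (map fst iks) \<subseteq> {0, 1}"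
    and G: "G_tau a i k n = foldr (\<lambda>(i, k). divided_power a i k) iks vac" by blast
  have "bar_graph a (G_tau a i k (Suc n)) (G_tau a i k (Suc n))"
    using bar_graph_divided_power[OF bar, of ?j ?m] unfolding divided_power_G_tau[OF assms] by simp
  moreover have "G_tau a i k (Suc n) = foldr (\<lambda>(i, k). divided_power a i k) ((?j, ?m) # iks) vac"
    unfolding divided_power_G_tau[OF assms, symmetric] G by simp
  moreover have "set (map fst ((?j, ?m) # iks)) \<subseteq> {0, 1}"
    using iks by auto
  ultimately show ?case by blast
qed

text \<open>Bar invariance and integrality hold because the element is obtained from the vacuum by divided
  powers, without any linear combination; the coefficients are read off from the explicit sum.\<close>

lemma is_canonical_G_tau:
  assumes "i < 2" and "k \<le> a"
  shows "is_canonical a (tau a i n (ones_first a k)) (G_tau a i k n)"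
  unfolding is_canonical_def
proof (intro conjI allI impI)
  let ?S0 = "ones_first a k"
  have S0: "?S0 \<in> choice_seqs a k" by (rule ones_first_in_choice_seqs[OF assms(2)])
  show "e_regular a (tau a i n ?S0)" by (rule e_regular_tau[OF assms])
  show "bar_graph a (G_tau a i k n) (G_tau a i k n)" using G_tau_monomial[OF assms(1)] by blast
  show "G_tau a i k n \<in> integral_form a"
    using G_tau_monomial[OF assms(1), of a k n]
      integral_form.monomial[OF _ one_in_int_laurent_polys integral_form.zero] by fastforce
  show "Poly_Mapping.lookup (G_tau a i k n) (tau a i n ?S0) = 1"
    using lookup_G_tau[OF assms(1) S0] Inv_eq_0_iff[OF S0] by simp
  fix la assume la: "la \<noteq> tau a i n ?S0"
  show "\<exists>p\<in>int_polys. Poly_Mapping.lookup (G_tau a i k n) la = v * p"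
  proof (cases "la \<in> tau a i n ` choice_seqs a k")
    case True
    then obtain S where S: "S \<in> choice_seqs a k" and la_eq: "la = tau a i n S" by blast
    with la have "Inv S \<noteq> 0" using Inv_eq_0_iff[OF S] by auto
    then obtain m where "Inv S = Suc m" by (cases "Inv S") auto
    then show ?thesis
      using lookup_G_tau[OF assms(1) S, of n] v_power_in_int_polys[of m] by (auto simp: la_eq)
  next
    case False
    have "0 \<in> int_polys" unfolding int_polys_def by (rule range_eqI[of _ _ 0]) simp
    then show ?thesis using lookup_G_tau_other[OF False] by (intro bexI[of _ 0]) simp_all
  qed
qed

text \<open>Each term has coefficient \<open>v\<close> to the power of an inversion number, so the shape counts choice sequences
  by inversions.\<close>

lemma shape_G_tau:
  assumes "a > 0" and "i < 2" and "k \<le> a"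
  shows "shape a (tau a i n (ones_first a k)) (G_tau a i k n) =
    map (\<lambda>l. s_num a (int k) (int l)) [0..<k * (a - k) + 1]"
proof -
  have "(\<Sum>la\<in>Poly_Mapping.keys (G_tau a i k n). v_coeff (Poly_Mapping.lookup (G_tau a i k n) la) l) =
      s_num a (int k) (int l)" for l
  proof -
    have "(\<Sum>la\<in>Poly_Mapping.keys (G_tau a i k n). v_coeff (Poly_Mapping.lookup (G_tau a i k n) la) l) =
        (\<Sum>S\<in>choice_seqs a k. v_coeff (Poly_Mapping.lookup (G_tau a i k n) (tau a i n S)) l)"
      by (simp add: keys_G_tau[OF assms(2)] sum.reindex[OF tau_inj[OF assms(2)]])
    also have "\<dots> = (\<Sum>S\<in>choice_seqs a k. if l = Inv S then 1 else 0)"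
      by (rule sum.cong) (simp_all add: lookup_G_tau[OF assms(2)] v_coeff_v_power)
    also have "\<dots> = int (card {S \<in> choice_seqs a k. Inv S = l})"
    proof -
      have "choice_seqs a k \<inter> {S. l = Inv S} = {S \<in> choice_seqs a k. Inv S = l}" by auto
      then show ?thesis by (simp add: sum.If_cases finite_choice_seqs)
    qed
    also have "\<dots> = s_num a (int k) (int l)" by (rule card_choice_seqs_Inv[OF assms(1)])
    finally show ?thesis .
  qed
  then show ?thesis
    unfolding shape_def defect_tau[OF assms(2,3)] nat_int by (simp del: upt_Suc)
qed

section \<open>Reduced words\<close>

lemma root_s_involution: "root_s j (root_s j x) = x"
  by (cases x) (simp add: root_s_def)

lemma reduced_word_tail:
  assumes "reduced_word (j # w)"
  shows "reduced_word w"
  unfolding reduced_word_def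
proof (intro conjI allI impI)
  show "set w \<subseteq> {0, 1}" using assms by (simp add: reduced_word_def)
  fix w' assume w': "set w' \<subseteq> {0, 1} \<and> foldr root_s w' = foldr root_s w"
  then have "set (j # w') \<subseteq> {0, 1} \<and> foldr root_s (j # w') = foldr root_s (j # w)"
    using assms by (simp add: reduced_word_def)
  with assms have "length (j # w) \<le> length (j # w')" unfolding reduced_word_def by blast
  then show "length w \<le> length w'" by simp
qed

text \<open>The generators are involutions, so a repeated letter could be removed.\<close>

lemma reduced_word_no_repeat: "\<not> reduced_word (j # j # w)"
proof
  assume red: "reduced_word (j # j # w)"
  have "foldr root_s w = foldr root_s (j # j # w)"
    by (simp add: fun_eq_iff root_s_involution)
  moreover have "set w \<subseteq> {0, 1}" using red by (simp add: reduced_word_def)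
  ultimately have "length (j # j # w) \<le> length w" using red unfolding reduced_word_def by blast
  then show False by simp
qed

text \<open>Reduced words alternate between the two letters. The last letter, which acts first, therefore determines
  each of them by its distance from the end.\<close>

lemma hd_reduced_word:
  assumes "reduced_word w" and "w \<noteq> []" and "last w \<noteq> i" and "i < 2"
  shows "hd w = (i + length w) mod 2"
  using assms(1-3)
proof (induction w)
  case (Cons j w)
  have j: "j \<in> {0, 1}" using Cons.prems(1) by (simp add: reduced_word_def)
  show ?case
  proof (cases w)
    case Nil
    then show ?thesis using j Cons.prems(3) \<open>i < 2\<close> by (auto simp: less_2_cases_iff)
  next
    case (Cons j' w')
    have "j \<noteq> j'" using Cons.prems(1) reduced_word_no_repeat Cons by blast
    moreover have "j' = (i + length w) mod 2"
      using Cons.IH[OF reduced_word_tail[OF Cons.prems(1)]] Cons Cons.prems(3) by simp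
    moreover have "j = (m + 1) mod 2" if "j = 0 \<or> j = 1" and "j \<noteq> m mod 2" for j m :: nat
      using that by presburger
    ultimately have "j = (i + length w + 1) mod 2" using j by (simp only: insert_iff empty_iff simp_thms)
    then show ?thesis by (simp only: list.sel list.size add.assoc One_nat_def)
  qed
qed simp

lemma crystal_word_tau:
  assumes "i < 2" and "k \<le> a" and "reduced_word w" and "w \<noteq> [] \<Longrightarrow> last w \<noteq> i"
  shows "crystal_word a w (tau a i 0 (ones_first a k)) = tau a i (length w) (ones_first a k)"
  using assms(3,4)
proof (induction w)
  case Nil
  then show ?case by (simp add: crystal_word_def)
next
  case (Cons j w)
  have "crystal_word a w (tau a i 0 (ones_first a k)) = tau a i (length w) (ones_first a k)"
    using Cons.IH[OF reduced_word_tail[OF Cons.prems(1)]] Cons.prems(2) by (cases "w = []") auto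
  moreover have "j = (i + length w + 1) mod 2"
    using hd_reduced_word[OF Cons.prems(1) _ _ assms(1)] Cons.prems(2) by simp
  ultimately show ?case
    using crystal_s_tau[OF assms(1,2), of "length w"] by (simp add: crystal_word_def)
qed

theorem lemma4p4:
  fixes a i k n :: nat and w :: "nat list"
  assumes "a \<ge> 1" and "i \<in> {0, 1}" and "k \<le> a"
    and "reduced_word w" and "length w = n"
    and "w \<noteq> [] \<Longrightarrow> last w \<noteq> i"
  shows "(\<exists>!mu. e_regular a mu \<and> weight a mu = top_weight i k) \<and>
    (\<forall>mu. e_regular a mu \<and> weight a mu = top_weight i k \<longrightarrow>
      (let S0 = replicate k 1 @ replicate (a - k) 0;
           G = (\<Sum>S\<in>choice_seqs a k. Poly_Mapping.single (tau a i n S) (v ^ Inv S))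
       in crystal_word a w mu = tau a i n S0 \<and>
          is_canonical a (crystal_word a w mu) G \<and>
          shape a (tau a i n S0) G = map (\<lambda>l. s_num a (int k) (int l)) [0..<k * (a - k) + 1]))"
proof -
  have i: "i < 2" using assms(2) by auto
  let ?top = "tau a i 0 (ones_first a k)"
  have top: "e_regular a ?top \<and> weight a ?top = top_weight i k"
    using e_regular_tau_0[OF i assms(3)] weight_tau_0[OF i assms(3)] by blast
  have unique: "mu = ?top" if "e_regular a mu \<and> weight a mu = top_weight i k" for mu
    using e_regular_top_weight[OF _ _ i string_source_empty[OF i], of a mu k] that
      string_state_empty[OF i assms(3)] by simp
  have word: "crystal_word a w ?top = tau a i n (ones_first a k)"
    using crystal_word_tau[OF i assms(3,4,6)] assms(5) by simp
  have "crystal_word a w ?top = tau a i n (ones_first a k) \<and>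
      is_canonical a (crystal_word a w ?top) (G_tau a i k n) \<and>
      shape a (tau a i n (ones_first a k)) (G_tau a i k n) =
        map (\<lambda>l. s_num a (int k) (int l)) [0..<k * (a - k) + 1]"
    unfolding word using is_canonical_G_tau[OF i assms(3)] shape_G_tau[OF _ i assms(3)] assms(1) by simp
  with top unique show ?thesis
    unfolding Let_def G_tau_def ones_first_def by blast
qed

end
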